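(* Let $a,b$ be coprime positive integers and let $k\ge 1$. A periodic $x$-parking function consisting of $k$ cycles can be decomposed into $k$ blocks, each conforming to the structure of the basic $x$-parking function. For $$x=\Bigl(1,\underbrace{\tfrac{a-1}{b},\ldots,\tfrac{a-1}{b}}_{b-1},\ \tfrac{a+b-1}{b},\underbrace{\tfrac{a-1}{b},\ldots,\tfrac{a-1}{b}}_{b-1},\ \tfrac{a+b-1}{b},\ldots\Bigr),$$ a vector of length $kb$ consisting of $k$ cycles of length $b$ (the first entry is $1$, and each of the other $k-1$ cycles begins with $\frac{a+b-1}{b}$), one has $$P_{kb}(x)=(a,b)\text{-}PF_{kb}=\sum_{J\in spec(k,b)}\binom{kb}{j_1,\ldots,j_k}\prod_{i=1}^{k}\left(1+j_i\,\frac{a-1}{b}\right)^{j_i-1},$$ where $spec(k,b)=\{J=(j_1,\ldots,j_k) : j_1\ge b,\ \ldots,\ j_1+\cdots+j_t\ge tb,\ \ldots,\ j_1+\cdots+j_k=kb,\ j_i\ge 0\}$.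
   Context: $\mathbb{N}$ includes $0$. For $x=(x_1,\ldots,x_n)\in\mathbb{N}^n$, an $x$-parking function is a sequence of positive integers $(c_1,\ldots,c_n)$ whose non-decreasing rearrangement satisfies $c_{(i)}\le x_1+\cdots+x_i$ for all $1\le i\le n$. The number of them is $P_n(x)=\sum_{(a_1,\ldots,a_n)\in park(n)}x_{a_1}\cdots x_{a_n}$, where $park(n)$ is the set of classical parking functions of length $n$ (positive integer sequences with $a_{(i)}\le i$ for all $i$). For rational $x$, $P_n(x)$ is given by this same polynomial, and the corresponding sequences are considered after multiplying $x$ by a positive integer that makes its entries integral. A basic $x$-parking function is an $x$-parking function for a vector of the form $x=(\alpha,\beta,\ldots,\beta)$ of length $n$; for these, $P_n(x)=\alpha(\alpha+n\beta)^{n-1}$. A periodic $x$-parking function consisting of $k$ cycles is one for a vector $x$ of the periodic shape displayed in the claim, with $k$ cycles of length $b$. $(a,b)\text{-}PF_{kb}$ denotes the number of $(ka,kb)$-parking functions (rational, or vector, parking functions of length $kb$): lattice paths with North and East steps from $(0,0)$ to $(kb,ka)$ staying weakly below the line $y=\frac ab x$, with the East steps labeled bijectively by a $kb$-element ordered set so that labels increase along consecutive East steps. Equivalently, they are sequences of positive integers $(c_1,\ldots,c_{kb})$ whose non-decreasing rearrangement satisfies $c_{(i+1)}\le 1+\lfloor i\frac{a}{b}\rfloor$ for $0\le i\le kb-1$. $\binom{kb}{j_1,\ldots,j_k}$ is the multinomial coefficient; a factor with $j_i=0$ equals $1$. *)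

theory Defs
  imports Complex_Main
begin

text \<open>Vectors and sequences are lists, indexed from 0; \<open>sort c ! i\<close> is the entry \<open>c\<^sub>(\<^sub>i\<^sub>+\<^sub>1\<^sub>)\<close> of
  the non-decreasing rearrangement.\<close>

definition vector_parking :: "nat list \<Rightarrow> nat list \<Rightarrow> bool" where
  "vector_parking x c \<longleftrightarrow>
     length c = length x \<and> (\<forall>v\<in>set c. 0 < v) \<and>
     (\<forall>i<length x. sort c ! i \<le> sum_list (take (Suc i) x))"

definition park :: "nat \<Rightarrow> nat list set" where
  "park n = {c. length c = n \<and> (\<forall>v\<in>set c. 0 < v) \<and> (\<forall>i<n. sort c ! i \<le> Suc i)}"

text \<open>The polynomial \<open>P\<^sub>n(x)\<close>, where \<open>n\<close> is the length of \<open>x\<close>.\<close>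

definition parking_poly :: "'a::comm_semiring_1 list \<Rightarrow> 'a" where
  "parking_poly x = (\<Sum>c\<in>park (length x). prod_list (map (\<lambda>v. x ! (v - 1)) c))"

definition basic_vector :: "'a \<Rightarrow> 'a \<Rightarrow> nat \<Rightarrow> 'a list" where
  "basic_vector \<alpha> \<beta> n = (if n = 0 then [] else \<alpha> # replicate (n - 1) \<beta>)"

definition basic_parking :: "nat \<Rightarrow> nat \<Rightarrow> nat list \<Rightarrow> bool" where
  "basic_parking \<alpha> \<beta> c \<longleftrightarrow> vector_parking (basic_vector \<alpha> \<beta> (length c)) c"

definition periodic_vector :: "nat \<Rightarrow> nat \<Rightarrow> nat \<Rightarrow> rat list" where
  "periodic_vector a b k =
     (1 # replicate (b - 1) ((of_nat a - 1) / of_nat b)) @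
     concat (replicate (k - 1)
       ((of_nat a + of_nat b - 1) / of_nat b # replicate (b - 1) ((of_nat a - 1) / of_nat b)))"

definition spec :: "nat \<Rightarrow> nat \<Rightarrow> nat list set" where
  "spec k b = {J. length J = k \<and> (\<forall>t\<in>{1..k}. t * b \<le> sum_list (take t J)) \<and> sum_list J = k * b}"

definition multinomial :: "nat \<Rightarrow> nat list \<Rightarrow> nat" where
  "multinomial n J = fact n div prod_list (map fact J)"

text \<open>A decomposition of a sequence \<open>c\<close> into \<open>k\<close> blocks, given by the position sets
  \<open>B\<^sub>0, \<dots>, B\<^sub>k\<^sub>-\<^sub>1\<close> of its blocks. A basic \<open>(\<alpha>, \<beta>, \<dots>, \<beta>)\<close>-block with \<open>j\<close> entries ends at height
  \<open>\<alpha> + j\<beta>\<close> and the next block starts there, so block \<open>t\<close> has to be a basic parking function after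
  lowering its entries by the sum of \<open>\<alpha> + j\<^sub>s\<beta>\<close> over all \<open>s < t\<close>. The subtraction is truncated, but
  entries of a parking function are positive, so every entry must exceed the offset.\<close>

definition block_decomposition :: "nat \<Rightarrow> nat \<Rightarrow> nat \<Rightarrow> nat \<Rightarrow> nat list \<Rightarrow> nat set list \<Rightarrow> bool" where
  "block_decomposition \<alpha> \<beta> k b c B \<longleftrightarrow>
     length B = k \<and> \<Union>(set B) = {..<length c} \<and>
     (\<forall>s<k. \<forall>t<k. s \<noteq> t \<longrightarrow> B ! s \<inter> B ! t = {}) \<and>
     map card B \<in> spec k b \<and>
     (\<forall>t<k. basic_parking \<alpha> \<beta>
        (map (\<lambda>v. v - (\<Sum>s<t. \<alpha> + card (B ! s) * \<beta>)) (nths c (B ! t))))"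

text \<open>Lattice paths from the origin whose East steps carry labels.\<close>

datatype step = North | East (label: nat)

definition norths :: "step list \<Rightarrow> nat" where
  "norths p = length (filter (\<lambda>s. s = North) p)"

definition easts :: "step list \<Rightarrow> nat" where
  "easts p = length (filter (\<lambda>s. s \<noteq> North) p)"

definition east_labels :: "step list \<Rightarrow> nat list" where
  "east_labels p = map label (filter (\<lambda>s. s \<noteq> North) p)"

text \<open>A path is weakly below the line \<open>y = (a/b) x\<close> iff all its lattice points
  \<open>(easts, norths)\<close>, the end points of its prefixes, are.\<close>

definition rational_parking :: "nat \<Rightarrow> nat \<Rightarrow> nat \<Rightarrow> step list set" where
  "rational_parking a b k =
     {p. norths p = k * a \<and> easts p = k * b \<and>
         (\<forall>m\<le>length p. (of_nat (norths (take m p)) :: rat)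
             \<le> of_nat a / of_nat b * of_nat (easts (take m p))) \<and>
         distinct (east_labels p) \<and> set (east_labels p) = {1..k * b} \<and>
         (\<forall>i l l'. Suc i < length p \<longrightarrow> p ! i = East l \<longrightarrow> p ! Suc i = East l' \<longrightarrow> l < l')}"

text \<open>The number \<open>(a,b)-PF\<^sub>k\<^sub>b\<close>.\<close>

definition PF :: "nat \<Rightarrow> nat \<Rightarrow> nat \<Rightarrow> nat" where
  "PF a b k = card (rational_parking a b k)"

end

theory Submission
  imports Defs "HOL-Computational_Algebra.Polynomial" "HOL-Library.Multiset"
begin

text \<open>Sort the entries of a parking function and cut greedily: block \<open>t\<close> ends at the first index \<open>m\<close>
  whose entry exceeds \<open>t + m\<beta>\<close>. This is the decomposition, and it turns the number of
  \<open>x\<close>-parking functions into the sum over \<open>spec k b\<close> whenever \<open>\<beta> = (a - 1) / b\<close> is a natural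
  number. For such \<open>a = 1 + b\<beta>\<close> the bounds \<open>1 + \<lfloor>i/b\<rfloor> + i\<beta>\<close> and \<open>1 + \<lfloor>ia/b\<rfloor>\<close> moreover agree, so that all
  three quantities of the theorem are equal. For fixed \<open>b\<close> and \<open>k\<close> each of them is a polynomial in \<open>a\<close>
  on the integers coprime to \<open>b\<close>, and polynomials that agree at infinitely many points are equal.
  For \<open>PF\<close> the polynomiality follows by induction on \<open>k\<close> from Bizley's recurrence
  \<open>ka PF\<^sub>k = \<Sum>\<^sub>j binom(kb, jb) (ja)\<^sup>j\<^sup>b PF\<^sub>k\<^sub>-\<^sub>j\<close>, a form of the cycle lemma, whose case \<open>k = 1\<close> also counts
  the basic parking functions.\<close>

text \<open>For general \<open>a\<close> the vector has fractional entries, so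
  \<open>parking_poly\<close> is not itself a count of sequences, and its prefix sums are not the
  bounds 1 + floor(ia/b) behind \<open>PF\<close>. The two sides count the same objects only when
  \<open>a = 1 + b * \<beta>\<close>; this is why the equalities are extended by polynomiality. A
  direct count for \<open>PF\<close> would have to deal with the residues of ia modulo b. Bizley's
  recurrence avoids them: its weights count arbitrary sequences, so they are plain powers of ja.
  Coprimality enters because it lets the path meet the line only at ends of cycles. The
  decomposition claim is not a polynomial identity and has to be proved for every integral scaling
  of the vector. For this reason the staircase lemmas carry a general block start \<open>N\<close>;
  the enumeration uses them with \<open>N = 1\<close>.\<close>

section \<open>Sequences bounded in sorted order\<close>

text \<open>From here on entries start at 0, so \<open>below U n\<close> consists of the lists whose non-decreasing
  rearrangement satisfies \<open>s\<^sub>i < U i\<close>, because \<open>s\<^sub>i < h\<close> is equivalent to \<open>i < cnt h c\<close>.\<close>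

definition cnt :: "nat \<Rightarrow> nat list \<Rightarrow> nat" where
  "cnt h c = length (filter (\<lambda>v. v < h) c)"

definition below :: "(nat \<Rightarrow> nat) \<Rightarrow> nat \<Rightarrow> nat list set" where
  "below U n = {c. length c = n \<and> (\<forall>i<n. i < cnt (U i) c)}"

lemma cnt_mono: "h \<le> h' \<Longrightarrow> cnt h c \<le> cnt h' c"
  unfolding cnt_def by (induction c) auto

lemma cnt_le_length: "cnt h c \<le> length c"
  by (simp add: cnt_def)

lemma cnt_eq_length_iff: "cnt h c = length c \<longleftrightarrow> (\<forall>v\<in>set c. v < h)"
  by (metis cnt_def filter_id_conv length_filter_less less_irrefl)

lemma cnt_filter_less: "cnt x (filter (\<lambda>v. v < h) c) = cnt (min x h) c"
  unfolding cnt_def by (induction c) auto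

lemma cnt_shift_filter: "cnt x (map (\<lambda>v. v - h) (filter (\<lambda>v. \<not> v < h) c)) = cnt (x + h) c - cnt h c"
proof -
  have "cnt x (map (\<lambda>v. v - h) (filter (\<lambda>v. \<not> v < h) c)) + cnt h c = cnt (x + h) c"
    unfolding cnt_def by (induction c) auto
  then show ?thesis by simp
qed

lemma cnt_less_imp_less: "cnt h c < cnt h' c \<Longrightarrow> h < h'"
  using cnt_mono[of h' h c] by linarith

lemma below_cong: "(\<And>i. i < n \<Longrightarrow> U i = V i) \<Longrightarrow> below U n = below V n"
  by (auto simp: below_def)

lemma below_0 [simp]: "below U 0 = {[]}"
  by (auto simp: below_def)

text \<open>The condition at the last index alone forces all entries below one fixed bound.\<close>

lemma finite_below: "finite (below U n)"
proof (cases n)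
  case (Suc m)
  have "below U n \<subseteq> {c. set c \<subseteq> {..<U m} \<and> length c = n}"
  proof
    fix c assume c: "c \<in> below U n"
    then have "m < cnt (U m) c" "length c = n"
      using Suc by (auto simp: below_def)
    then have "cnt (U m) c = length c"
      using cnt_le_length[of "U m" c] Suc by linarith
    then have "\<forall>v\<in>set c. v < U m"
      by (simp only: cnt_eq_length_iff)
    then show "c \<in> {c. set c \<subseteq> {..<U m} \<and> length c = n}"
      using \<open>length c = n\<close> by auto
  qed
  then show ?thesis
    by (rule finite_subset) (simp add: finite_lists_length_eq)
qed simp

text \<open>A list is determined by its entries below \<open>h\<close>, its entries from
  \<open>h\<close> on, and the way the two are interleaved; \<open>shuffles\<close> collects the
  interleavings. Both Bizley's recurrence and the greedy decomposition count through this.\<close>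

lemma card_split:
  fixes h :: nat
  assumes A: "\<And>u. u \<in> A \<Longrightarrow> length u = m \<and> (\<forall>v\<in>set u. v < h)"
    and B: "\<And>w. w \<in> B \<Longrightarrow> length w = r" and fin: "finite A" "finite B"
  shows "card {c. filter (\<lambda>v. v < h) c \<in> A \<and> map (\<lambda>v. v - h) (filter (\<lambda>v. \<not> v < h) c) \<in> B}
    = ((m + r) choose m) * card A * card B"
proof -
  let ?L = "filter (\<lambda>v::nat. v < h)" and ?R = "filter (\<lambda>v::nat. \<not> v < h)"
  let ?S = "\<lambda>(u, w). shuffles u (map (\<lambda>v. v + h) w)"
  have rec: "?L c = u \<and> map (\<lambda>v. v - h) (?R c) = w"
    if "(u, w) \<in> A \<times> B" "c \<in> ?S (u, w)" for c u w
  proof -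
    have *: "\<forall>v\<in>set u. v < h" using that A by auto
    have "?L c \<in> shuffles (?L u) (?L (map (\<lambda>v. v + h) w))"
      "?R c \<in> shuffles (?R u) (?R (map (\<lambda>v. v + h) w))"
      using that(2) filter_shuffles by fastforce+
    moreover have "?L u = u" "?R u = []" "?L (map (\<lambda>v. v + h) w) = []"
      "?R (map (\<lambda>v. v + h) w) = map (\<lambda>v. v + h) w"
      using * by (auto simp: filter_empty_conv filter_map o_def)
    ultimately have "?L c = u" "?R c = map (\<lambda>v. v + h) w" by auto
    then show ?thesis by (simp add: o_def)
  qed
  have "{c. ?L c \<in> A \<and> map (\<lambda>v. v - h) (?R c) \<in> B} = (\<Union>p\<in>A \<times> B. ?S p)"
  proof (intro equalityI subsetI)
    fix c assume c: "c \<in> {c. ?L c \<in> A \<and> map (\<lambda>v. v - h) (?R c) \<in> B}"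
    have "c \<in> shuffles (?L c) (?R c)" by (rule partition_in_shuffles)
    moreover have "map (\<lambda>v. v + h) (map (\<lambda>v. v - h) (?R c)) = ?R c"
      unfolding map_map by (rule map_idI) auto
    ultimately have "c \<in> ?S (?L c, map (\<lambda>v. v - h) (?R c))" by simp
    then show "c \<in> (\<Union>p\<in>A \<times> B. ?S p)" using c by blast
  qed (use rec in fastforce)
  also have "card \<dots> = (\<Sum>p\<in>A \<times> B. card (?S p))"
  proof (rule card_UN_disjoint)
    show "\<forall>p\<in>A \<times> B. \<forall>q\<in>A \<times> B. p \<noteq> q \<longrightarrow> ?S p \<inter> ?S q = {}"
    proof (intro ballI impI equals0I)
      fix p q c assume *: "p \<in> A \<times> B" "q \<in> A \<times> B" "p \<noteq> q" "c \<in> ?S p \<inter> ?S q"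
      obtain u w u' w' where "p = (u, w)" "q = (u', w')" by (cases p, cases q)
      then show False using rec[of u w c] rec[of u' w' c] * by blast
    qed
  qed (use fin in auto)
  also have "\<dots> = (\<Sum>p\<in>A \<times> B. (m + r) choose m)"
  proof (rule sum.cong)
    fix p assume "p \<in> A \<times> B"
    then obtain u w where p: "p = (u, w)" "u \<in> A" "w \<in> B" by auto
    have "set u \<inter> set (map (\<lambda>v. v + h) w) = {}" using A p by fastforce
    from card_disjoint_shuffles[OF this] show "card (?S p) = (m + r) choose m"
      using A B p by simp
  qed simp
  finally show ?thesis by (simp add: card_cartesian_product)
qed

text \<open>The sequences equivalent to labelled paths below the line, with the bound 1 +
  floor(ia/b); it stays unchanged because lowering the entries to start at 0 turns \<le> into
  <.\<close>

definition dominated :: "nat \<Rightarrow> nat \<Rightarrow> nat \<Rightarrow> nat list set" where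
  "dominated a b k = below (\<lambda>i. Suc (i * a div b)) (k * b)"

text \<open>The bound is moved from indices to heights. The sorted entry at index
  \<open>cnt h c\<close> is the first one that is at least \<open>h\<close>, so its bound yields the
  inequality at \<open>h\<close>; conversely, an index \<open>i\<close> that fails makes the height
  \<open>Suc (i * a div b)\<close> fail.\<close>

lemma dominated_iff:
  assumes "0 < a" "0 < b"
  shows "c \<in> dominated a b k \<longleftrightarrow>
    length c = k * b \<and> (\<forall>h\<le>k * a. b * h \<le> a * cnt h c)"
proof (intro iffI conjI allI impI)
  assume c: "c \<in> dominated a b k"
  then show "length c = k * b" by (simp add: dominated_def below_def)
  fix h assume h: "h \<le> k * a"
  show "b * h \<le> a * cnt h c"
  proof (cases "cnt h c < k * b")
    case True
    then have "cnt h c < cnt (Suc (cnt h c * a div b)) c"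
      using c by (simp add: dominated_def below_def)
    then have "h \<le> cnt h c * a div b"
      by (metis cnt_less_imp_less less_Suc_eq_le)
    then show ?thesis
      using assms by (metis less_eq_div_iff_mult_less_eq mult.commute)
  next
    case False
    have "b * h \<le> b * (k * a)" using h by simp
    also have "\<dots> = a * (k * b)" by simp
    also have "\<dots> \<le> a * cnt h c" using False by (intro mult_le_mono) auto
    finally show ?thesis .
  qed
next
  assume c: "length c = k * b \<and> (\<forall>h\<le>k * a. b * h \<le> a * cnt h c)"
  have "i < cnt (Suc (i * a div b)) c" if i: "i < k * b" for i
  proof (rule ccontr)
    let ?h = "Suc (i * a div b)"
    assume "\<not> i < cnt ?h c"
    then have le: "a * cnt ?h c \<le> i * a" by simp
    have gt: "i * a < b * ?h"
      using assms by (metis dividend_less_times_div mult_Suc_right add.commute)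
    \<comment> \<open>A height above \<open>k * a\<close> is outside the range of the assumption,
      but it would force \<open>i\<close> to be at least \<open>k * b\<close>.\<close>
    show False
    proof (cases "?h \<le> k * a")
      case True
      then show False using c le gt by (metis leD le_trans)
    next
      case False
      then have "k * a \<le> i * a div b" by simp
      then have "k * a * b \<le> i * a"
        using assms by (simp add: less_eq_div_iff_mult_less_eq)
      then have "(k * b) * a \<le> i * a" by (simp add: ac_simps)
      then show False using i assms(1) by simp
    qed
  qed
  then show "c \<in> dominated a b k" using c by (simp add: dominated_def below_def)
qed

lemma dominated_less:
  assumes "0 < a" "0 < b" "c \<in> dominated a b k" "v \<in> set c"
  shows "v < k * a"
proof -
  have "b * (k * a) \<le> a * cnt (k * a) c" "length c = k * b"
    using assms by (auto simp: dominated_iff)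
  then have "a * length c \<le> a * cnt (k * a) c" by (simp add: ac_simps)
  then have "cnt (k * a) c = length c" using assms(1) cnt_le_length[of "k * a" c] by simp
  then show ?thesis using assms(4) by (simp only: cnt_eq_length_iff)
qed

section \<open>Bizley's recurrence\<close>

text \<open>Subtraction of \<open>q\<close> modulo \<open>n\<close> on the values below
  \<open>n\<close>.\<close>

definition rot :: "nat \<Rightarrow> nat \<Rightarrow> nat \<Rightarrow> nat" where
  "rot n q v = (if v < q then v + (n - q) else v - q)"

lemma cnt_rot_low:
  assumes "\<forall>v\<in>set c. v < n" "q \<le> n" "h \<le> n - q"
  shows "cnt h (map (rot n q) c) + cnt q c = cnt (q + h) c"
  using assms unfolding cnt_def by (induction c) (auto simp: rot_def)

lemma cnt_rot_high:
  assumes "\<forall>v\<in>set c. v < n" "q \<le> n" "n - q \<le> h" "h \<le> n"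
  shows "cnt h (map (rot n q) c) + cnt q c = length c + cnt (h - (n - q)) c"
  using assms unfolding cnt_def by (induction c) (auto simp: rot_def)

text \<open>\<open>marked a b j p\<close> are the bridges whose level \<open>a \<cdot> cnt h u - b \<cdot> h\<close> is non-negative and does not
  vanish on \<open>[p, ja)\<close>. Rotating an arbitrary bridge to the first minimum \<open>q\<close> of its level gives such
  a sequence with \<open>p = ja - q\<close>, and this is bijective.\<close>

definition marked :: "nat \<Rightarrow> nat \<Rightarrow> nat \<Rightarrow> nat \<Rightarrow> nat list set" where
  "marked a b j p = {u \<in> dominated a b j. \<forall>h. p \<le> h \<and> h < j * a \<longrightarrow> b * h < a * cnt h u}"

text \<open>Integer-valued, because the level of an arbitrary sequence may become negative.\<close>

definition level :: "nat \<Rightarrow> nat \<Rightarrow> nat list \<Rightarrow> nat \<Rightarrow> int" where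
  "level a b c h = int a * int (cnt h c) - int b * int h"

lemma level_ge_0_iff: "0 \<le> level a b c h \<longleftrightarrow> b * h \<le> a * cnt h c"
  unfolding level_def by (simp flip: of_nat_mult)

lemma level_gr_0_iff: "0 < level a b c h \<longleftrightarrow> b * h < a * cnt h c"
  unfolding level_def by (simp flip: of_nat_mult)

lemma level_rot_low:
  assumes "\<forall>v\<in>set c. v < n" "q \<le> n" "h \<le> n - q"
  shows "level a b (map (rot n q) c) h = level a b c (q + h) - level a b c q"
proof -
  have "int (cnt h (map (rot n q) c)) = int (cnt (q + h) c) - int (cnt q c)"
    using cnt_rot_low[OF assms] by linarith
  then show ?thesis unfolding level_def by (simp only:) (simp add: algebra_simps)
qed

lemma level_rot_high:
  assumes "\<forall>v\<in>set c. v < n" "q \<le> n" "n - q \<le> h" "h \<le> n" and bal: "a * length c = b * n"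
  shows "level a b (map (rot n q) c) h = level a b c (h - (n - q)) - level a b c q"
proof -
  have "int (cnt h (map (rot n q) c)) = int (length c) + int (cnt (h - (n - q)) c) - int (cnt q c)"
    using cnt_rot_high[OF assms(1-4)] by linarith
  moreover have "int (h - (n - q)) = int h - int n + int q"
    using assms by linarith
  moreover have "int a * int (length c) = int b * int n"
    using bal by (metis of_nat_mult)
  ultimately show ?thesis unfolding level_def by (simp only:) (simp add: algebra_simps)
qed

text \<open>Rotation by \<open>q\<close> shifts the level cyclically and subtracts its value at
  \<open>q\<close>. Non-negativity thus says that \<open>q\<close> is a minimum. The heights from
  \<open>j * a - q\<close> on are the wrapped ones, which lay below \<open>q\<close> before, so
  strict positivity there says that no earlier minimum exists.\<close>

lemma rot_in_marked_iff:
  assumes "0 < a" "0 < b" and c: "length c = j * b" "\<forall>v\<in>set c. v < j * a" and q: "q < j * a"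
  shows "map (rot (j * a) q) c \<in> marked a b j (j * a - q) \<longleftrightarrow>
    (\<forall>h<j * a. level a b c q \<le> level a b c h) \<and> (\<forall>h<q. level a b c q < level a b c h)"
    (is "?u \<in> _ \<longleftrightarrow> ?R")
proof -
  let ?n = "j * a" and ?L = "level a b c"
  have bal: "a * length c = b * ?n" using c by simp
  have low: "level a b ?u h = ?L (q + h) - ?L q" if "h \<le> ?n - q" for h
    by (rule level_rot_low) (use c q that in auto)
  have high: "level a b ?u h = ?L (h - (?n - q)) - ?L q" if "?n - q \<le> h" "h \<le> ?n" for h
    by (rule level_rot_high) (use c q that bal in auto)
  \<comment> \<open>The level has the same value at both ends, so the cyclic shift fits together at
    the seam.\<close>
  have end0: "?L ?n = ?L 0"
  proof -
    have "cnt ?n c = length c" using c(2) by (simp only: cnt_eq_length_iff)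
    moreover have "int a * int (length c) = int b * int ?n" using bal by (metis of_nat_mult)
    ultimately show ?thesis by (simp add: level_def) (simp add: cnt_def)
  qed
  have "?u \<in> marked a b j (?n - q) \<longleftrightarrow>
      (\<forall>h\<le>?n. 0 \<le> level a b ?u h) \<and> (\<forall>h. ?n - q \<le> h \<and> h < ?n \<longrightarrow> 0 < level a b ?u h)"
    using assms by (simp add: marked_def dominated_iff level_ge_0_iff level_gr_0_iff)
  also have "\<dots> \<longleftrightarrow> ?R"
  proof (intro iffI conjI allI impI; (elim conjE)?)
    fix h assume nn: "\<forall>h\<le>?n. 0 \<le> level a b ?u h" and h: "h < ?n"
    show "?L q \<le> ?L h"
    proof (cases "q \<le> h")
      case True
      then show ?thesis using low[of "h - q"] nn[rule_format, of "h - q"] h by simp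
    next
      case False
      then show ?thesis
        using high[of "h + (?n - q)"] nn[rule_format, of "h + (?n - q)"] h q by simp
    qed
  next
    fix h assume pos: "\<forall>h. ?n - q \<le> h \<and> h < ?n \<longrightarrow> 0 < level a b ?u h" and h: "h < q"
    have "?n - q \<le> h + (?n - q) \<and> h + (?n - q) < ?n" using h q by linarith
    then have "0 < level a b ?u (h + (?n - q))" using pos by blast
    then show "?L q < ?L h"
      using high[of "h + (?n - q)"] h q by simp
  next
    fix h assume min: "\<forall>h<?n. ?L q \<le> ?L h" and h: "h \<le> ?n"
    have min': "?L q \<le> ?L x" if "x \<le> ?n" for x
      using min end0 that q by (cases "x = ?n") (force, simp)
    show "0 \<le> level a b ?u h"
      using low[of h] high[of h] h q min'[of "q + h"] min'[of "h - (?n - q)"]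
      by (cases "h \<le> ?n - q") auto
  next
    fix h assume first: "\<forall>h<q. ?L q < ?L h" and h: "?n - q \<le> h" "h < ?n"
    have "h - (?n - q) < q" using h q by linarith
    then show "0 < level a b ?u h"
      using high[of h] h first by simp
  qed
  finally show ?thesis .
qed

lemma bij_betw_map_rot:
  assumes "q \<le> n"
  shows "bij_betw (map (rot n q)) {c. set c \<subseteq> {..<n} \<and> length c = m} {c. set c \<subseteq> {..<n} \<and> length c = m}"
proof (rule bij_betw_byWitness[where f' = "map (rot n (n - q))"])
  have "map (rot n (n - q)) (map (rot n q) c) = c" "map (rot n q) (map (rot n (n - q)) c) = c"
    if "set c \<subseteq> {..<n}" for c
    unfolding map_map using assms that by (intro map_idI; force simp: rot_def)+
  then show "\<forall>c\<in>{c. set c \<subseteq> {..<n} \<and> length c = m}. map (rot n (n - q)) (map (rot n q) c) = c"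
    "\<forall>c\<in>{c. set c \<subseteq> {..<n} \<and> length c = m}. map (rot n q) (map (rot n (n - q)) c) = c"
    by auto
qed (use assms in \<open>force simp: rot_def\<close>)+

lemma sum_card_marked:
  assumes "0 < a" "0 < b" "0 < j"
  shows "(\<Sum>p=1..j * a. card (marked a b j p)) = (j * a) ^ (j * b)"
proof -
  let ?n = "j * a"
  define W where "W = {c. set c \<subseteq> {..<?n} \<and> length c = j * b}"
  define R where "R q = {c \<in> W. map (rot ?n q) c \<in> marked a b j (?n - q)}" for q
  have n: "0 < ?n" using assms by simp
  have finW: "finite W" unfolding W_def by (simp add: finite_lists_length_eq)
  have R: "c \<in> R q \<longleftrightarrow> c \<in> W \<and> (\<forall>h<?n. level a b c q \<le> level a b c h) \<and>
      (\<forall>h<q. level a b c q < level a b c h)" if "q < ?n" for c q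
    using rot_in_marked_iff[OF assms(1,2) _ _ that, of c] by (auto simp: R_def W_def)
  have mW: "marked a b j p \<subseteq> W" for p
  proof
    fix c assume "c \<in> marked a b j p"
    then have c: "c \<in> dominated a b j" by (simp add: marked_def)
    then have "length c = j * b" using assms by (simp add: dominated_iff)
    moreover have "\<forall>v\<in>set c. v < ?n" using dominated_less[OF assms(1,2) c] by blast
    ultimately show "c \<in> W" by (auto simp: W_def)
  qed
  have cardR: "card (R q) = card (marked a b j (?n - q))" if "q < ?n" for q
  proof -
    have bij: "bij_betw (map (rot ?n q)) W W"
      unfolding W_def by (rule bij_betw_map_rot) (use that in simp)
    have "map (rot ?n q) ` R q = marked a b j (?n - q)"
    proof (intro equalityI subsetI)
      fix u assume u: "u \<in> marked a b j (?n - q)"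
      then obtain c where "c \<in> W" "u = map (rot ?n q) c"
        using mW bij by (metis bij_betw_imp_surj_on imageE subsetD)
      then show "u \<in> map (rot ?n q) ` R q" using u by (auto simp: R_def)
    qed (auto simp: R_def)
    moreover have "inj_on (map (rot ?n q)) (R q)"
      using bij by (auto simp: bij_betw_def R_def intro: inj_on_subset)
    ultimately show ?thesis by (metis card_image)
  qed
  have W: "W = (\<Union>q\<in>{..<?n}. R q)"
  proof (intro equalityI subsetI)
    fix c assume c: "c \<in> W"
    let ?P = "\<lambda>q. q < ?n \<and> (\<forall>h<?n. level a b c q \<le> level a b c h)"
    have "\<exists>m. is_arg_min (level a b c) (\<lambda>q. q \<in> {..<?n}) m"
      by (rule ex_is_arg_min_if_finite) (use n in \<open>simp_all add: lessThan_empty_iff\<close>)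
    then obtain m where m: "is_arg_min (level a b c) (\<lambda>q. q \<in> {..<?n}) m" ..
    then have "?P m" by (auto simp: is_arg_min_linorder)
    \<comment> \<open>The minimum found so far need not be the first one; the least minimising index
      is.\<close>
    then have P: "?P (LEAST q. ?P q)" by (rule LeastI)
    define q where "q = (LEAST q. ?P q)"
    have "level a b c q < level a b c h" if "h < q" for h
    proof (rule ccontr)
      assume "\<not> ?thesis"
      then have "?P h" using P that unfolding q_def[symmetric] by force
      then show False using not_less_Least[of h ?P] that unfolding q_def by blast
    qed
    then show "c \<in> (\<Union>q\<in>{..<?n}. R q)" using P c R unfolding q_def[symmetric] by auto
  qed (auto simp: R_def)
  have disj: "R q \<inter> R q' = {}" if "q < q'" "q' < ?n" for q q'
  proof (rule equals0I)
    fix c assume "c \<in> R q \<inter> R q'"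
    then have "level a b c q \<le> level a b c q'" "level a b c q' < level a b c q"
      using that by (simp_all add: R)
    then show False by simp
  qed
  have "card (\<Union>q\<in>{..<?n}. R q) = (\<Sum>q<?n. card (R q))"
  proof (rule card_UN_disjoint)
    show "\<forall>q\<in>{..<?n}. finite (R q)"
      using finW by (simp add: R_def)
    show "\<forall>q\<in>{..<?n}. \<forall>q'\<in>{..<?n}. q \<noteq> q' \<longrightarrow> R q \<inter> R q' = {}"
    proof (intro ballI impI)
      fix q q' assume "q \<in> {..<?n}" "q' \<in> {..<?n}" "q \<noteq> q'"
      then consider "q < q'" "q' < ?n" | "q' < q" "q < ?n" by fastforce
      then show "R q \<inter> R q' = {}"
        by cases (use disj in blast)+
    qed
  qed simp
  then have "card W = (\<Sum>q<?n. card (R q))" using W by simp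
  also have "\<dots> = (\<Sum>q<?n. card (marked a b j (?n - q)))" using cardR by simp
  also have "\<dots> = (\<Sum>p=1..?n. card (marked a b j p))"
    by (rule sum.reindex_bij_witness[of _ "\<lambda>p. ?n - p" "\<lambda>q. ?n - q"]) auto
  finally show ?thesis by (simp add: W_def card_lists_length_eq)
qed

lemma length_filter_not_less: "length (filter (\<lambda>v. \<not> v < h) c) = length c - cnt h c"
  using sum_length_filter_compl[of "\<lambda>v. v < h" c] by (simp add: cnt_def)

text \<open>Count pairs \<open>(c, p)\<close> with \<open>1 \<le> p \<le> ka\<close> by the first zero \<open>h \<ge> p\<close> of the level of \<open>c\<close>. Coprimality
  forces \<open>h = ja\<close>; below \<open>h\<close> one sees a marked sequence and above \<open>h\<close> an arbitrary dominated one.\<close>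

lemma dominated_recurrence:
  assumes "0 < a" "0 < b" "coprime a b"
  shows "k * a * card (dominated a b k) =
    (\<Sum>j=1..k. (k * b choose (j * b)) * (j * a) ^ (j * b) * card (dominated a b (k - j)))"
proof -
  note dom = dominated_iff[OF assms(1,2)]
  define X where "X j p = {c. filter (\<lambda>v. v < j * a) c \<in> marked a b j p \<and>
    map (\<lambda>v. v - j * a) (filter (\<lambda>v. \<not> v < j * a) c) \<in> dominated a b (k - j)}" for j p
  have fin: "finite (dominated a b j)" for j by (simp add: dominated_def finite_below)
  have all_less: "\<forall>v\<in>set u. v < j * a" if "u \<in> dominated a b j" for u j
    using dominated_less[OF assms(1,2) that] by blast
  have length_dom: "length u = j * b" if "u \<in> dominated a b j" for u j
    using that by (simp add: dom)
  have cardX: "card (X j p) = (k * b choose (j * b)) * card (marked a b j p) * card (dominated a b (k - j))"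
    if "j \<le> k" for j p
  proof -
    have "j * b + (k - j) * b = k * b" using that by (metis add_mult_distrib le_add_diff_inverse)
    then show ?thesis unfolding X_def
      by (subst card_split[where m = "j * b" and r = "(k - j) * b"])
        (use all_less fin in \<open>auto simp: marked_def length_dom\<close>)
  qed
  have cntX: "cnt (j * a) c = j * b" if "c \<in> X j p" for c j p
    using that by (simp add: X_def marked_def dom cnt_def)
  \<comment> \<open>The level vanishes at \<open>j * a\<close>, so the levels of the two pieces, put
    one after the other, form the level of \<open>c\<close>.\<close>
  have Xsub: "c \<in> dominated a b k" if c: "c \<in> X j p" and j: "j \<le> k" for c j p
  proof -
    have u: "b * h \<le> a * cnt (min h (j * a)) c" if "h \<le> j * a" for h
      using c that by (simp add: X_def marked_def dom cnt_filter_less)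
    have w: "b * h \<le> a * (cnt (h + j * a) c - j * b)" if "h \<le> (k - j) * a" for h
      using c that cntX[OF c] by (simp add: X_def dom cnt_shift_filter)
    have "length c - j * b = (k - j) * b"
      using c cntX[OF c] by (simp add: X_def dom length_filter_not_less)
    moreover have "j * b \<le> length c" using cntX[OF c] cnt_le_length by metis
    ultimately have "length c = k * b"
      using j by (metis add_mult_distrib le_add_diff_inverse)
    moreover have "b * h \<le> a * cnt h c" if h: "h \<le> k * a" for h
    proof (cases "h \<le> j * a")
      case True then show ?thesis using u[OF True] by simp
    next
      case False
      have "h - j * a \<le> (k - j) * a" using h by (simp add: diff_mult_distrib)
      from w[OF this] False have *: "b * (h - j * a) \<le> a * (cnt h c - j * b)" by simp
      have "j * b \<le> cnt h c" using cntX[OF c] cnt_mono[of "j * a" h c] False by simp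
      then have "a * cnt h c = a * (cnt h c - j * b) + a * (j * b)"
        by (metis add_mult_distrib2 le_add_diff_inverse2)
      moreover have "b * h = b * (h - j * a) + b * (j * a)"
        using False by (metis add_mult_distrib2 le_add_diff_inverse2 nat_le_linear)
      moreover have "a * (j * b) = b * (j * a)" by simp
      ultimately show ?thesis using * by linarith
    qed
    ultimately show ?thesis by (simp add: dom)
  qed
  have decomp: "dominated a b k = (\<Union>j\<in>{j\<in>{1..k}. p \<le> j * a}. X j p)" if p: "p \<in> {1..k * a}" for p
  proof (intro equalityI subsetI)
    fix c assume c: "c \<in> dominated a b k"
    let ?P = "\<lambda>h. p \<le> h \<and> h \<le> k * a \<and> b * h = a * cnt h c"
    have len: "length c = k * b" using c by (simp add: dom)
    \<comment> \<open>The level is 0 again at the top height, so a first zero from \<open>p\<close>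
      on exists.\<close>
    have "cnt (k * a) c = k * b"
      using all_less[OF c] len by (metis cnt_eq_length_iff)
    then have "?P (k * a)" using p by simp
    then have P: "?P (LEAST h. ?P h)" by (rule LeastI)
    define h where "h = (LEAST h. ?P h)"
    have min: "\<not> ?P x" if "x < h" for x using that not_less_Least unfolding h_def by blast
    have h: "p \<le> h" "h \<le> k * a" "b * h = a * cnt h c" using P unfolding h_def by auto
    have "a dvd h" using h(3) assms(3) by (metis coprime_dvd_mult_right_iff dvd_triv_left)
    then obtain j where j: "h = j * a" by (metis dvd_div_mult_self)
    have "a * cnt h c = b * (j * a)" using h(3) unfolding j by (rule sym)
    also have "\<dots> = a * (j * b)" by (simp only: ac_simps)
    finally have "a * cnt h c = a * (j * b)" .
    then have cnth: "cnt h c = j * b" using assms(1) by simp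
    have "j \<le> k" using h(2) j assms(1) by simp
    then have j1: "j \<in> {1..k}" using h(1) p j by (cases j) auto
    have ge: "b * x \<le> a * cnt x c" if "x \<le> k * a" for x using c that by (simp add: dom)
    have "filter (\<lambda>v. v < j * a) c \<in> marked a b j p"
      unfolding marked_def mem_Collect_eq dom cnt_filter_less
    proof (intro conjI allI impI)
      show "length (filter (\<lambda>v. v < j * a) c) = j * b" using cnth by (simp add: cnt_def j)
      show "b * x \<le> a * cnt (min x (j * a)) c" if "x \<le> j * a" for x
        using ge[of x] that h j by simp
      show "b * x < a * cnt (min x (j * a)) c" if "p \<le> x \<and> x < j * a" for x
        using ge[of x] min[of x] that h j by simp
    qed
    moreover have "map (\<lambda>v. v - j * a) (filter (\<lambda>v. \<not> v < j * a) c) \<in> dominated a b (k - j)"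
      unfolding dom cnt_shift_filter length_map length_filter_not_less
    proof (intro conjI allI impI)
      show "length c - cnt (j * a) c = (k - j) * b"
        using cnth len by (simp add: j diff_mult_distrib)
      fix x assume "x \<le> (k - j) * a"
      then have "x + h \<le> k * a" using h(2) unfolding j diff_mult_distrib by linarith
      from ge[OF this] have "b * x \<le> a * cnt (x + h) c - a * cnt h c"
        using h by (simp add: algebra_simps)
      then show "b * x \<le> a * (cnt (x + j * a) c - cnt (j * a) c)"
        by (simp add: j diff_mult_distrib2)
    qed
    ultimately show "c \<in> (\<Union>j\<in>{j\<in>{1..k}. p \<le> j * a}. X j p)"
      using j1 h j by (auto simp: X_def)
  qed (use Xsub in auto)
  \<comment> \<open>A member of \<open>X i p\<close> has level 0 at \<open>i * a\<close>, which the
    marking of \<open>X j p\<close> forbids between \<open>p\<close> and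
    \<open>j * a\<close>.\<close>
  have disj: "X i p \<inter> X j p = {}" if "p \<le> i * a" "i < j" for i j p
  proof (rule ccontr)
    assume "X i p \<inter> X j p \<noteq> {}"
    then obtain c where ci: "c \<in> X i p" and cj: "c \<in> X j p" by blast
    have "b * (i * a) < a * cnt (min (i * a) (j * a)) c"
      using cj that assms(1) by (simp add: X_def marked_def cnt_filter_less)
    then show False using cntX[OF ci] that assms(1) by (simp add: ac_simps)
  qed
  have "k * a * card (dominated a b k) = (\<Sum>p=1..k * a. card (dominated a b k))" by simp
  also have "\<dots> = (\<Sum>p=1..k * a. \<Sum>j\<in>{j\<in>{1..k}. p \<le> j * a}. card (X j p))"
  proof (rule sum.cong)
    fix p assume p: "p \<in> {1..k * a}"
    have finX: "finite (X j p)" if "j \<in> {1..k}" for j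
      by (rule finite_subset[OF _ fin[of k]]) (use that Xsub in auto)
    show "card (dominated a b k) = (\<Sum>j\<in>{j\<in>{1..k}. p \<le> j * a}. card (X j p))"
      unfolding decomp[OF p]
    proof (intro card_UN_disjoint ballI impI)
      fix i j assume "i \<in> {j \<in> {1..k}. p \<le> j * a}" "j \<in> {j \<in> {1..k}. p \<le> j * a}" "i \<noteq> j"
      then show "X i p \<inter> X j p = {}"
        using disj[of p i j] disj[of p j i] by (metis (no_types, lifting) Int_commute linorder_neqE_nat mem_Collect_eq)
    qed (use finX in auto)
  qed simp
  \<comment> \<open>With \<open>j\<close> outermost, the marks \<open>p\<close> run through 1..ja,
    the range over which \<open>sum_card_marked\<close> adds up.\<close>
  also have "\<dots> = (\<Sum>j=1..k. \<Sum>p\<in>{p\<in>{1..k * a}. p \<le> j * a}. card (X j p))"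
    by (rule sum.swap_restrict) auto
  also have "\<dots> = (\<Sum>j=1..k. \<Sum>p=1..j * a. card (X j p))"
  proof (rule sum.cong)
    fix j assume "j \<in> {1..k}"
    then have "j * a \<le> k * a" by simp
    then have "{p\<in>{1..k * a}. p \<le> j * a} = {1..j * a}"
      unfolding set_eq_iff mem_Collect_eq atLeastAtMost_iff by (meson le_trans)
    then show "(\<Sum>p\<in>{p\<in>{1..k * a}. p \<le> j * a}. card (X j p)) = (\<Sum>p=1..j * a. card (X j p))"
      by simp
  qed simp
  also have "\<dots> = (\<Sum>j=1..k. (k * b choose (j * b)) * (j * a) ^ (j * b) * card (dominated a b (k - j)))"
  proof (rule sum.cong)
    fix j assume j: "j \<in> {1..k}"
    have "(\<Sum>p=1..j * a. card (X j p)) =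
        (k * b choose (j * b)) * (\<Sum>p=1..j * a. card (marked a b j p)) * card (dominated a b (k - j))"
      using j by (simp add: cardX sum_distrib_left sum_distrib_right)
    then show "(\<Sum>p=1..j * a. card (X j p)) =
        (k * b choose (j * b)) * (j * a) ^ (j * b) * card (dominated a b (k - j))"
      using sum_card_marked[OF assms(1,2), of j] j by simp
  qed simp
  finally show ?thesis .
qed

text \<open>The recurrence for \<open>k = 1\<close> has one term and can be divided by
  \<open>a\<close>.\<close>

lemma card_dominated_1:
  assumes "0 < a" "0 < b" "coprime a b"
  shows "card (dominated a b 1) = a ^ (b - 1)"
proof -
  have "a * card (dominated a b 1) = a ^ b"
    using dominated_recurrence[OF assms, of 1] by (simp add: dominated_def)
  also have "\<dots> = a * a ^ (b - 1)" using assms by (simp add: power_eq_if)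
  finally show ?thesis using assms by simp
qed

lemma coprime_1_add_mult: "coprime (1 + m * n) (m :: nat)"
  by (rule coprimeI) (metis dvd_add_left_iff dvd_mult2)

text \<open>The slope (1 + j\<beta>)/j exceeds \<beta> by 1/j, and the surplus i/j stays below 1 for
  i < j, so the floor removes it. Basic sequences are therefore rational ones with a single cycle
  and a coprime slope.\<close>

lemma card_below_basic: "card (below (\<lambda>i. 1 + i * \<beta>) j) = (1 + j * \<beta>) ^ (j - 1)"
proof (cases "j = 0")
  case False
  have "below (\<lambda>i. 1 + i * \<beta>) j = dominated (1 + j * \<beta>) j 1"
    unfolding dominated_def mult_1
  proof (rule below_cong)
    fix i assume "i < j"
    then have "(i + j * (i * \<beta>)) div j = i * \<beta>" by simp
    then show "1 + i * \<beta> = Suc (i * (1 + j * \<beta>) div j)" by (simp add: algebra_simps)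
  qed
  moreover have "coprime (1 + j * \<beta>) j" by (rule coprime_1_add_mult)
  ultimately show ?thesis
    using card_dominated_1[of "1 + j * \<beta>" j] False by simp
qed simp

section \<open>The greedy decomposition\<close>

text \<open>Capping \<open>i div b\<close> makes the first \<open>t\<close> blocks, with \<open>m\<close> entries in total, a family closed under
  removal of the last block; for \<open>m = tb\<close> the cap is inactive.\<close>

definition stair :: "nat \<Rightarrow> nat \<Rightarrow> nat \<Rightarrow> nat \<Rightarrow> nat \<Rightarrow> nat list set" where
  "stair N \<beta> b t m = below (\<lambda>i. N * min (Suc (i div b)) t + i * \<beta>) m"

text \<open>The height \<open>N * t + m' * \<beta>\<close> is where \<open>t\<close> blocks with
  \<open>m'\<close> entries in total end; what lies above it has to form one further basic
  block.\<close>

definition stair_split :: "nat \<Rightarrow> nat \<Rightarrow> nat \<Rightarrow> nat \<Rightarrow> nat \<Rightarrow> nat \<Rightarrow> nat list set" where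
  "stair_split N \<beta> b t m m' = {c.
     filter (\<lambda>v. v < N * t + m' * \<beta>) c \<in> stair N \<beta> b t m' \<and>
     map (\<lambda>v. v - (N * t + m' * \<beta>)) (filter (\<lambda>v. \<not> v < N * t + m' * \<beta>) c) \<in>
       below (\<lambda>i. N + i * \<beta>) (m - m')}"

text \<open>Expresses the conditions on both pieces through counts in \<open>c\<close> itself, so
  that they can be compared with the staircase index by index.\<close>

lemma stair_split_iff:
  assumes "m' \<le> m"
  shows "c \<in> stair_split N \<beta> b t m m' \<longleftrightarrow> length c = m \<and> cnt (N * t + m' * \<beta>) c = m' \<and>
    (\<forall>i<m'. i < cnt (N * min (Suc (i div b)) t + i * \<beta>) c) \<and>
    (\<forall>i<m - m'. m' + i < cnt (N * Suc t + (m' + i) * \<beta>) c)"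
proof -
  let ?h = "N * t + m' * \<beta>"
  \<comment> \<open>The bounds of the first \<open>t\<close> blocks do not exceed the cut height, so
    dropping the entries above it leaves these counts unchanged.\<close>
  have 1: "min (N * min (Suc (i div b)) t + i * \<beta>) ?h = N * min (Suc (i div b)) t + i * \<beta>"
    if "i < m'" for i
    using that by (intro min_absorb1 add_mono mult_le_mono) auto
  have 2: "N + i * \<beta> + ?h = N * Suc t + (m' + i) * \<beta>" for i
    by (simp add: algebra_simps)
  have "c \<in> stair_split N \<beta> b t m m' \<longleftrightarrow> (cnt ?h c = m' \<and>
      (\<forall>i<m'. i < cnt (N * min (Suc (i div b)) t + i * \<beta>) c)) \<and>
      (length c - cnt ?h c = m - m' \<and> (\<forall>i<m - m'. i < cnt (N * Suc t + (m' + i) * \<beta>) c - cnt ?h c))"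
    unfolding stair_split_def stair_def below_def mem_Collect_eq length_map length_filter_not_less
      cnt_shift_filter cnt_filter_less 2 using 1 by (auto simp flip: cnt_def)
  also have "\<dots> \<longleftrightarrow> length c = m \<and> cnt ?h c = m' \<and>
      (\<forall>i<m'. i < cnt (N * min (Suc (i div b)) t + i * \<beta>) c) \<and>
      (\<forall>i<m - m'. m' + i < cnt (N * Suc t + (m' + i) * \<beta>) c)"
    using assms cnt_le_length[of ?h c] by (auto simp: less_diff_conv add.commute)
  finally show ?thesis .
qed

lemma stair_Suc:
  assumes "0 < b" "t * b \<le> m"
  shows "stair N \<beta> b (Suc t) m = (\<Union>m'\<in>{t * b..m}. stair_split N \<beta> b t m m')"
proof (intro equalityI subsetI)
  fix c assume c: "c \<in> stair N \<beta> b (Suc t) m"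
  then have len: "length c = m" by (simp add: stair_def below_def)
  have U: "i < cnt (N * min (Suc (i div b)) (Suc t) + i * \<beta>) c" if "i < m" for i
    using c that by (simp add: stair_def below_def)
  \<comment> \<open>The condition says that the sorted entry at index \<open>m'\<close> reaches
    \<open>N * t + m' * \<beta>\<close>, or that the list ends there. The least such
    \<open>m'\<close> is the greedy cut after \<open>t\<close> blocks.\<close>
  let ?P = "\<lambda>m'. m' \<le> m \<and> cnt (N * t + m' * \<beta>) c \<le> m'"
  have "?P m" using cnt_le_length[of _ c] len by auto
  then have P: "?P (LEAST m'. ?P m')" by (rule LeastI)
  define m' where "m' = (LEAST m'. ?P m')"
  have m': "m' \<le> m" "cnt (N * t + m' * \<beta>) c \<le> m'" using P by (simp_all add: m'_def)
  have low: "i < cnt (N * t + i * \<beta>) c" if "i < m'" for i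
    using not_less_Least[of i ?P] that m' unfolding m'_def[symmetric] by simp
  \<comment> \<open>At indices below \<open>t * b\<close> the staircase itself keeps the entries
    under the cutting height, so no cut can occur there. This is the origin of the inequalities in
    \<open>spec\<close>.\<close>
  have ge: "t * b \<le> m'"
  proof (rule ccontr)
    assume "\<not> ?thesis"
    then have "m' div b < t" "m' < m" using assms by (simp_all add: div_less_iff_less_mult)
    then have "m' < cnt (N * Suc (m' div b) + m' * \<beta>) c" using U[of m'] by simp
    also have "\<dots> \<le> cnt (N * t + m' * \<beta>) c"
      using \<open>m' div b < t\<close> by (intro cnt_mono add_mono mult_le_mono) auto
    finally show False using m' by simp
  qed
  have "c \<in> stair_split N \<beta> b t m m'"
    unfolding stair_split_iff[OF m'(1)]
  proof (intro conjI allI impI len)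
    show "cnt (N * t + m' * \<beta>) c = m'"
    proof (cases m')
      case (Suc i)
      then have "i < cnt (N * t + i * \<beta>) c" using low by simp
      also have "\<dots> \<le> cnt (N * t + m' * \<beta>) c" using Suc by (intro cnt_mono) simp
      finally show ?thesis using m' Suc by simp
    qed (use m' in simp)
    show "i < cnt (N * min (Suc (i div b)) t + i * \<beta>) c" if "i < m'" for i
      using low[OF that] U[of i] that m' by (cases "Suc (i div b) \<le> t") (auto simp: min_def)
    show "m' + i < cnt (N * Suc t + (m' + i) * \<beta>) c" if "i < m - m'" for i
    proof -
      \<comment> \<open>From index \<open>t * b\<close> on the capped term is constant, so the bound
        has the shape of a single basic block.\<close>
      have "t \<le> (m' + i) div b" using ge assms(1) by (simp add: less_eq_div_iff_mult_less_eq)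
      then have "min (Suc ((m' + i) div b)) (Suc t) = Suc t" by simp
      then show ?thesis using U[of "m' + i"] that by simp
    qed
  qed
  then show "c \<in> (\<Union>m'\<in>{t * b..m}. stair_split N \<beta> b t m m')" using ge m' by auto
next
  fix c assume "c \<in> (\<Union>m'\<in>{t * b..m}. stair_split N \<beta> b t m m')"
  then obtain m' where m': "t * b \<le> m'" "m' \<le> m" and c: "c \<in> stair_split N \<beta> b t m m'" by auto
  note c = c[unfolded stair_split_iff[OF m'(2)]]
  have "i < cnt (N * min (Suc (i div b)) (Suc t) + i * \<beta>) c" if "i < m" for i
  proof (cases "i < m'")
    case True
    then have "i < cnt (N * min (Suc (i div b)) t + i * \<beta>) c" using c by blast
    also have "\<dots> \<le> cnt (N * min (Suc (i div b)) (Suc t) + i * \<beta>) c"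
      by (intro cnt_mono add_mono mult_le_mono) auto
    finally show ?thesis .
  next
    case False
    then have "i < cnt (N * Suc t + i * \<beta>) c"
      using c that by (metis diff_less_mono le_add_diff_inverse not_less)
    moreover have "t \<le> i div b" using m' False assms(1) by (simp add: less_eq_div_iff_mult_less_eq)
    ultimately show ?thesis by simp
  qed
  then show "c \<in> stair N \<beta> b (Suc t) m" using c by (simp add: stair_def below_def)
qed

text \<open>The cut can be recovered from \<open>c\<close>: at the cut the count equals the index,
  while at every earlier index the count is larger.\<close>

lemma stair_split_disjoint:
  assumes "m' < m''" "m'' \<le> m"
  shows "stair_split N \<beta> b t m m' \<inter> stair_split N \<beta> b t m m'' = {}"
proof (rule equals0I)
  fix c assume c: "c \<in> stair_split N \<beta> b t m m' \<inter> stair_split N \<beta> b t m m''"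
  then have "m' < cnt (N * min (Suc (m' div b)) t + m' * \<beta>) c"
    using assms by (simp add: stair_split_iff)
  also have "\<dots> \<le> cnt (N * t + m' * \<beta>) c" by (intro cnt_mono add_mono mult_le_mono) auto
  finally show False using c assms by (simp add: stair_split_iff)
qed

lemma card_stair_split:
  assumes "m' \<le> m"
  shows "card (stair_split N \<beta> b t m m') =
    (m choose m') * card (stair N \<beta> b t m') * card (below (\<lambda>i. N + i * \<beta>) (m - m'))"
proof -
  have "u \<in> stair N \<beta> b t m' \<Longrightarrow> length u = m' \<and> (\<forall>v\<in>set u. v < N * t + m' * \<beta>)" for u
  proof -
    assume u: "u \<in> stair N \<beta> b t m'"
    have len: "length u = m'" using u by (simp add: stair_def below_def)
    have "length u \<le> cnt (N * t + m' * \<beta>) u"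
    proof (cases m')
      case (Suc i)
      then have "i < cnt (N * min (Suc (i div b)) t + i * \<beta>) u"
        using u by (simp add: stair_def below_def)
      also have "\<dots> \<le> cnt (N * t + m' * \<beta>) u"
        using Suc by (intro cnt_mono add_mono mult_le_mono) auto
      finally show ?thesis using Suc len by simp
    qed (use len in simp)
    then have "cnt (N * t + m' * \<beta>) u = length u" using cnt_le_length by (metis le_antisym)
    then have "\<forall>v\<in>set u. v < N * t + m' * \<beta>" by (simp only: cnt_eq_length_iff)
    then show ?thesis using len by blast
  qed
  moreover have "w \<in> below (\<lambda>i. N + i * \<beta>) (m - m') \<Longrightarrow> length w = m - m'" for w
    by (simp add: below_def)
  ultimately show ?thesis
    unfolding stair_split_def using assms
    by (subst card_split[where m = m' and r = "m - m'"]) (auto simp: stair_def finite_below)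
qed

lemma card_stair_Suc:
  assumes "0 < b" "t * b \<le> m"
  shows "card (stair N \<beta> b (Suc t) m) = (\<Sum>m'=t * b..m.
    (m choose m') * card (stair N \<beta> b t m') * card (below (\<lambda>i. N + i * \<beta>) (m - m')))"
proof -
  have fin: "finite (stair_split N \<beta> b t m m')" if "m' \<in> {t * b..m}" for m'
  proof (rule finite_subset)
    show "stair_split N \<beta> b t m m' \<subseteq> stair N \<beta> b (Suc t) m"
      using that stair_Suc[OF assms, of N \<beta>] by blast
  qed (simp add: stair_def finite_below)
  have "card (stair N \<beta> b (Suc t) m) = (\<Sum>m'=t * b..m. card (stair_split N \<beta> b t m m'))"
    unfolding stair_Suc[OF assms]
  proof (intro card_UN_disjoint ballI impI)
    fix x y assume "x \<in> {t * b..m}" "y \<in> {t * b..m}" "x \<noteq> y"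
    then consider "x < y" "y \<le> m" | "y < x" "x \<le> m" by fastforce
    then show "stair_split N \<beta> b t m x \<inter> stair_split N \<beta> b t m y = {}"
      by cases (use stair_split_disjoint in blast)+
  qed (use fin in auto)
  then show ?thesis by (simp add: card_stair_split)
qed

text \<open>\<open>spec\<close> with a free total \<open>m\<close>: removing the last part leaves a
  total that need not be a multiple of \<open>b\<close>.\<close>

definition specs :: "nat \<Rightarrow> nat \<Rightarrow> nat \<Rightarrow> nat list set" where
  "specs t m b = {J. length J = t \<and> (\<forall>s\<in>{1..t}. s * b \<le> sum_list (take s J)) \<and> sum_list J = m}"

lemma spec_eq_specs: "spec k b = specs k (k * b) b"
  by (simp add: spec_def specs_def)

lemma finite_specs: "finite (specs t m b)"
proof (rule finite_subset)
  show "specs t m b \<subseteq> {J. set J \<subseteq> {..m} \<and> length J = t}"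
    by (auto simp: specs_def intro: member_le_sum_list)
qed (simp add: finite_lists_length_eq)

lemma snoc_in_specs_iff:
  "J @ [j] \<in> specs (Suc t) m b \<longleftrightarrow> Suc t * b \<le> m \<and> j \<le> m \<and> J \<in> specs t (m - j) b"
proof -
  have "J @ [j] \<in> specs (Suc t) m b \<longleftrightarrow> length J = t \<and>
      (\<forall>s\<in>{1..t}. s * b \<le> sum_list (take s (J @ [j]))) \<and> Suc t * b \<le> sum_list (take (Suc t) (J @ [j])) \<and>
      sum_list (J @ [j]) = m"
    by (auto simp: specs_def atLeastAtMostSuc_conv)
  also have "\<dots> \<longleftrightarrow> Suc t * b \<le> m \<and> j \<le> m \<and> J \<in> specs t (m - j) b"
    by (auto simp: specs_def)
  finally show ?thesis .
qed

text \<open>Makes the \<open>div\<close> in \<open>multinomial\<close> an exact division.\<close>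

lemma prod_fact_dvd: "prod_list (map fact J) dvd (fact (sum_list J) :: nat)"
proof (induction J)
  case (Cons j J)
  have "fact j * prod_list (map fact J) dvd fact j * (fact (sum_list J) :: nat)"
    using Cons by (rule mult_dvd_mono[OF dvd_refl])
  also have "\<dots> dvd fact (j + sum_list J)" by (rule fact_fact_dvd_fact)
  finally show ?case by simp
qed simp

lemma multinomial_snoc:
  "multinomial (sum_list J + j) (J @ [j]) = (sum_list J + j choose sum_list J) * multinomial (sum_list J) J"
proof -
  let ?P = "prod_list (map fact J) :: nat"
  obtain q where q: "fact (sum_list J) = ?P * q" using prod_fact_dvd by blast
  have pos: "0 < ?P" by (induction J) auto
  have "fact (sum_list J) * fact j * (sum_list J + j choose sum_list J) = (fact (sum_list J + j) :: nat)"
    using binomial_fact_lemma[of "sum_list J" "sum_list J + j"] by simp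
  then have "fact (sum_list J + j) = ?P * fact j * ((sum_list J + j choose sum_list J) * q)"
    using q by (simp add: ac_simps)
  then show ?thesis using pos q by (simp add: multinomial_def)
qed

text \<open>Iterates \<open>card_stair_Suc\<close>. The last part of \<open>J\<close> is
  \<open>m - m'\<close>, and the binomial coefficients multiply up to the multinomial one.\<close>

lemma card_stair:
  assumes "0 < b" "t * b \<le> m"
  shows "card (stair N \<beta> b t m) =
    (\<Sum>J\<in>specs t m b. multinomial m J * (\<Prod>i<t. card (below (\<lambda>i. N + i * \<beta>) (J ! i))))"
  using assms(2)
proof (induction t arbitrary: m)
  case 0
  show ?case
  proof (cases "m = 0")
    case True
    then have "specs 0 m b = {[]}" by (auto simp: specs_def)
    then show ?thesis using True by (simp add: stair_def multinomial_def)
  next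
    case False
    then have "specs 0 m b = {}" by (auto simp: specs_def)
    \<comment> \<open>With cap 0 the bound at index 0 is 0, and no entry lies below it.\<close>
    moreover have "stair N \<beta> b 0 m = {}" using False by (auto simp: stair_def below_def cnt_def)
    ultimately show ?thesis by simp
  qed
next
  case (Suc t)
  define g where "g j = card (below (\<lambda>i. N + i * \<beta>) j)" for j
  have tb: "t * b \<le> m" using Suc.prems by simp
  have "card (stair N \<beta> b (Suc t) m) = (\<Sum>m'=t * b..m. (m choose m') * card (stair N \<beta> b t m') * g (m - m'))"
    by (simp add: card_stair_Suc[OF assms(1) tb] g_def)
  also have "\<dots> = (\<Sum>m'=t * b..m. \<Sum>J\<in>specs t m' b.
      (m choose m') * (multinomial m' J * (\<Prod>i<t. g (J ! i))) * g (m - m'))"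
    by (intro sum.cong refl) (simp add: Suc.IH g_def sum_distrib_left sum_distrib_right)
  also have "\<dots> = (\<Sum>(m', J)\<in>(SIGMA m':{t * b..m}. specs t m' b).
      (m choose m') * (multinomial m' J * (\<Prod>i<t. g (J ! i))) * g (m - m'))"
    by (rule sum.Sigma) (auto simp: finite_specs)
  also have "\<dots> = (\<Sum>J\<in>specs (Suc t) m b. multinomial m J * (\<Prod>i<Suc t. g (J ! i)))"
  proof (rule sum.reindex_bij_witness[where i = "\<lambda>J. (sum_list (butlast J), butlast J)"
        and j = "\<lambda>(m', J). J @ [m - m']"])
    fix p assume "p \<in> (SIGMA m':{t * b..m}. specs t m' b)"
    then obtain m' J where p: "p = (m', J)" and m': "m' \<in> {t * b..m}" and J: "J \<in> specs t m' b"
      by blast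
    then have sum: "sum_list J = m'" and len: "length J = t" by (auto simp: specs_def)
    show "(sum_list (butlast (case p of (m', J) \<Rightarrow> J @ [m - m'])),
        butlast (case p of (m', J) \<Rightarrow> J @ [m - m'])) = p"
      using sum by (simp add: p)
    show "(case p of (m', J) \<Rightarrow> J @ [m - m']) \<in> specs (Suc t) m b"
      using m' J Suc.prems by (simp add: snoc_in_specs_iff p)
    have "(\<Prod>i<t. g ((J @ [m - m']) ! i)) = (\<Prod>i<t. g (J ! i))"
      using len by (intro prod.cong) (auto simp: nth_append)
    then show "multinomial m (case p of (m', J) \<Rightarrow> J @ [m - m']) *
        (\<Prod>i<Suc t. g ((case p of (m', J) \<Rightarrow> J @ [m - m']) ! i)) =
        (case p of (m', J) \<Rightarrow>
          (m choose m') * (multinomial m' J * (\<Prod>i<t. g (J ! i))) * g (m - m'))"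
      using m' len multinomial_snoc[of J "m - m'"] sum by (simp add: nth_append p)
  next
    fix J assume J: "J \<in> specs (Suc t) m b"
    then obtain J' j where J': "J = J' @ [j]"
      by (cases J rule: rev_cases) (auto simp: specs_def)
    then have *: "j \<le> m" "J' \<in> specs t (m - j) b" using J by (auto simp: snoc_in_specs_iff)
    then have sum: "sum_list J' = m - j" "length J' = t" by (auto simp: specs_def)
    show "(\<lambda>(m', J). J @ [m - m']) (sum_list (butlast J), butlast J) = J"
      using J' * sum by simp
    have "\<forall>s\<in>{1..t}. s * b \<le> sum_list (take s J')" using *(2) by (simp add: specs_def)
    then have "t * b \<le> sum_list (take t J')" if "t \<noteq> 0" by (rule bspec) (use that in simp)
    then have "t * b \<le> m - j" using sum by (cases "t = 0") auto
    then show "(sum_list (butlast J), butlast J) \<in> (SIGMA m':{t * b..m}. specs t m' b)"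
      using J' * sum by simp
  qed
  finally show ?case by (simp add: g_def)
qed

text \<open>The induction of \<open>card_stair\<close>, with the blocks kept instead of counted. A
  block collects the values between two consecutive offsets; the bound by the last offset ensures
  that no entry is left over.\<close>

lemma stair_decomposition:
  assumes "0 < b" "t * b \<le> m" "c \<in> stair N \<beta> b t m"
  shows "\<exists>J\<in>specs t m b. (\<forall>v\<in>set c. v < (\<Sum>i<t. N + J ! i * \<beta>)) \<and>
    (\<forall>s<t. map (\<lambda>v. v - (\<Sum>i<s. N + J ! i * \<beta>))
      (filter (\<lambda>v. (\<Sum>i<s. N + J ! i * \<beta>) \<le> v \<and> v < (\<Sum>i<Suc s. N + J ! i * \<beta>)) c)
      \<in> below (\<lambda>i. N + i * \<beta>) (J ! s))"
  using assms(2,3)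
proof (induction t arbitrary: m c)
  case 0
  then have "m = 0"
    by (cases m) (auto simp: stair_def below_def cnt_def dest!: spec[of _ 0])
  then show ?case using 0 by (auto simp: stair_def specs_def)
next
  case (Suc t)
  have tb: "t * b \<le> m" using Suc.prems by simp
  obtain m' where m': "t * b \<le> m'" "m' \<le> m" and c: "c \<in> stair_split N \<beta> b t m m'"
    using Suc.prems stair_Suc[OF assms(1) tb] by auto
  define h where "h = N * t + m' * \<beta>"
  let ?u = "filter (\<lambda>v. v < h) c" and ?w = "map (\<lambda>v. v - h) (filter (\<lambda>v. \<not> v < h) c)"
  have u: "?u \<in> stair N \<beta> b t m'" and w: "?w \<in> below (\<lambda>i. N + i * \<beta>) (m - m')"
    using c by (simp_all add: stair_split_def h_def)
  from Suc.IH[OF m'(1) u] obtain J where J: "J \<in> specs t m' b"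
    and J_below: "\<And>s. s < t \<Longrightarrow> map (\<lambda>v. v - (\<Sum>i<s. N + J ! i * \<beta>))
      (filter (\<lambda>v. (\<Sum>i<s. N + J ! i * \<beta>) \<le> v \<and> v < (\<Sum>i<Suc s. N + J ! i * \<beta>)) ?u)
      \<in> below (\<lambda>i. N + i * \<beta>) (J ! s)"
    by blast
  define J' where "J' = J @ [m - m']"
  define off where "off s = (\<Sum>i<s. N + J' ! i * \<beta>)" for s
  have len: "length J = t" and sum: "sum_list J = m'" using J by (auto simp: specs_def)
  have J'_nth: "J' ! i = J ! i" if "i < t" for i using that len by (simp add: J'_def nth_append)
  have off_eq: "off s = (\<Sum>i<s. N + J ! i * \<beta>)" if "s \<le> t" for s
    unfolding off_def using that by (intro sum.cong) (auto simp: J'_nth)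
  \<comment> \<open>The offset depends on the parts only through their number and sum, so it is the
    cut height of \<open>stair_split\<close>.\<close>
  have off_t: "off t = h"
  proof -
    have "off t = N * t + (\<Sum>i<t. J ! i) * \<beta>"
      by (simp add: off_eq sum.distrib sum_distrib_right)
    then show ?thesis using len sum by (simp add: h_def sum_list_sum_nth atLeast0LessThan)
  qed
  have off_mono: "s \<le> s' \<Longrightarrow> off s \<le> off s'" for s s'
    unfolding off_def by (rule sum_mono2) auto
  have off_Suc: "off (Suc t) = h + N + (m - m') * \<beta>"
    using off_t len by (simp add: off_def J'_def nth_append)
  \<comment> \<open>The bound at the last index of the upper piece limits all of its
    entries.\<close>
  have top: "v < off (Suc t)" if v: "v \<in> set c" for v
  proof (cases "v < h")
    case False
    then have in_w: "v - h \<in> set ?w" using v by auto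
    have len_w: "length ?w = m - m'" using w by (simp add: below_def)
    have "m - m' \<noteq> 0" using length_pos_if_in_set[OF in_w] unfolding len_w by simp
    then have "m - m' - 1 < cnt (N + (m - m' - 1) * \<beta>) ?w"
      using w unfolding below_def mem_Collect_eq by simp
    moreover note len_w
    moreover have "cnt (N + (m - m' - 1) * \<beta>) ?w \<le> cnt (N + (m - m') * \<beta>) ?w"
      by (intro cnt_mono add_mono mult_le_mono) auto
    ultimately have "cnt (N + (m - m') * \<beta>) ?w = length ?w"
      using cnt_le_length[of "N + (m - m') * \<beta>" ?w] by linarith
    then have "v - h < N + (m - m') * \<beta>" using in_w unfolding cnt_eq_length_iff by blast
    then show ?thesis using False by (simp add: off_Suc)
  qed (simp add: off_Suc)
  have "map (\<lambda>v. v - off s) (filter (\<lambda>v. off s \<le> v \<and> v < off (Suc s)) c)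
      \<in> below (\<lambda>i. N + i * \<beta>) (J' ! s)" if s: "s < Suc t" for s
  proof (cases "s = t")
    case True
    have "filter (\<lambda>v. off s \<le> v \<and> v < off (Suc s)) c = filter (\<lambda>v. \<not> v < h) c"
      by (rule filter_cong) (use True top off_t in auto)
    moreover have "J' ! t = m - m'" using len by (metis J'_def nth_append_length)
    ultimately show ?thesis using w True off_t by simp
  next
    case False
    then have s: "s < t" using s by simp
    then have "off (Suc s) \<le> h" using off_mono[of "Suc s" t] off_t by simp
    then have "filter (\<lambda>v. off s \<le> v \<and> v < off (Suc s)) c =
        filter (\<lambda>v. off s \<le> v \<and> v < off (Suc s)) ?u"
      unfolding filter_filter by (intro filter_cong) auto
    then show ?thesis using J_below[OF s] s by (simp add: off_eq J'_nth del: filter_filter sum.lessThan_Suc)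
  qed
  moreover have "J' \<in> specs (Suc t) m b"
    using J m' Suc.prems by (simp add: J'_def snoc_in_specs_iff)
  ultimately show ?case using top unfolding off_def by blast
qed

section \<open>Vector parking functions and the parking polynomial\<close>

lemma cnt_sort: "cnt h (sort c) = cnt h c"
  by (simp add: cnt_def filter_sort)

lemma sorted_nth_less_iff: "sorted s \<Longrightarrow> i < length s \<Longrightarrow> s ! i < h \<longleftrightarrow> i < cnt h s"
proof (induction s arbitrary: i)
  case (Cons x s)
  show ?case
  proof (cases "x < h")
    case True
    then show ?thesis using Cons by (cases i) (auto simp: cnt_def)
  next
    case False
    then have "\<forall>v\<in>set (x # s). \<not> v < h" using Cons.prems by auto
    then have "cnt h (x # s) = 0" by (simp add: cnt_def filter_empty_conv)
    moreover have "\<not> (x # s) ! i < h" using \<open>\<forall>v\<in>set (x # s). \<not> v < h\<close> Cons.prems(2) nth_mem by blast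
    ultimately show ?thesis by simp
  qed
qed simp

lemma sort_nth_less_iff: "i < length c \<Longrightarrow> sort c ! i < h \<longleftrightarrow> i < cnt h c"
  using sorted_nth_less_iff[of "sort c" i h] by (simp add: cnt_sort)

lemma cnt_map_Suc: "cnt (Suc h) (map Suc c) = cnt h c"
  by (simp add: cnt_def filter_map o_def)

text \<open>Lowering positive entries by one turns \<le> into <, the form used by
  \<open>below\<close>.\<close>

lemma vector_parking_iff:
  "vector_parking x c \<longleftrightarrow> c \<in> map Suc ` below (\<lambda>i. sum_list (take (Suc i) x)) (length x)"
proof -
  have sort: "sort (map Suc d) ! i \<le> h \<longleftrightarrow> i < cnt h d" if "i < length d" for d i h
    using sort_nth_less_iff[of i "map Suc d" "Suc h"] that by (simp add: less_Suc_eq_le cnt_map_Suc)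
  show ?thesis
  proof
    assume c: "vector_parking x c"
    define d where "d = map (\<lambda>v. v - 1) c"
    have "map Suc d = c" unfolding d_def map_map by (rule map_idI) (use c in \<open>auto simp: vector_parking_def\<close>)
    then show "c \<in> map Suc ` below (\<lambda>i. sum_list (take (Suc i) x)) (length x)"
      using c sort[of _ d] by (intro image_eqI[of _ _ d]) (auto simp: vector_parking_def below_def)
  qed (auto simp: vector_parking_def below_def sort)
qed

lemma below_Suc_less:
  assumes "d \<in> below Suc n" "v \<in> set d"
  shows "v < n"
proof -
  have "n \<noteq> 0" using assms by (cases n) auto
  then obtain m where m: "n = Suc m" by (cases n) auto
  have "m < cnt n d" using assms unfolding below_def m by blast
  moreover have "length d = n" using assms by (simp add: below_def)
  ultimately have "cnt n d = length d" using cnt_le_length[of n d] m by linarith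
  then show ?thesis using assms(2) by (simp only: cnt_eq_length_iff)
qed

lemma park_eq: "park n = map Suc ` below Suc n"
proof -
  have "park n = {c. vector_parking (replicate n 1) c}"
    by (auto simp: park_def vector_parking_def sum_list_replicate)
  also have "\<dots> = map Suc ` below (\<lambda>i. sum_list (take (Suc i) (replicate n 1))) n"
    by (auto simp: vector_parking_iff)
  also have "below (\<lambda>i. sum_list (take (Suc i) (replicate n 1))) n = below Suc n"
    by (rule below_cong) (simp add: sum_list_replicate)
  finally show ?thesis .
qed

lemma parking_poly_eq: "parking_poly x = (\<Sum>d\<in>below Suc (length x). prod_list (map ((!) x) d))"
  unfolding parking_poly_def park_eq
  by (subst sum.reindex) (auto simp: inj_on_def o_def map_injective dest: map_injective)

lemma card_map_fibre: "card {c. map f c = d} = prod_list (map (\<lambda>y. card {v. f v = y}) d)"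
proof (induction d)
  case (Cons y d)
  have "{c. map f c = y # d} = (\<lambda>(v, c). v # c) ` ({v. f v = y} \<times> {c. map f c = d})"
    by (auto simp: map_eq_Cons_conv)
  moreover have "inj_on (\<lambda>(v, c). v # c) A" for A :: "('a \<times> 'a list) set"
    by (auto simp: inj_on_def)
  ultimately show ?case using Cons by (simp add: card_image card_cartesian_product)
qed simp

text \<open>Cut the naturals into consecutive intervals whose lengths are the entries of
  \<open>x\<close>. Replacing each entry of a sequence by the index of its interval turns the
  prefix-sum bounds into the classical ones, and the fibre over a classical sequence has as many
  elements as its monomial says.\<close>

lemma card_below_prefix_sums:
  "card (below (\<lambda>i. sum_list (take (Suc i) x)) (length x)) = parking_poly x"
proof -
  define n where "n = length x"
  define S where "S i = sum_list (take i x)" for i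
  \<comment> \<open>The alternative \<open>i = n\<close> guarantees that the minimum exists and
    sends values beyond all intervals to the index \<open>n\<close>.\<close>
  define f where "f v = (LEAST i. i = n \<or> v < S (Suc i))" for v
  have S_mono: "S i \<le> S j" if "i \<le> j" for i j
  proof -
    have "take j x = take i x @ drop i (take j x)" using that
      by (metis append_take_drop_id min.absorb1 take_take)
    then show ?thesis unfolding S_def by (metis le_add1 sum_list_append)
  qed
  have f_le_iff: "f v \<le> i \<longleftrightarrow> v < S (Suc i)" if "i < n" for v i
  proof
    assume "f v \<le> i"
    moreover have "f v = n \<or> v < S (Suc (f v))"
      unfolding f_def by (rule LeastI[of "\<lambda>i. i = n \<or> v < S (Suc i)" n]) simp
    ultimately show "v < S (Suc i)" using that S_mono[of "Suc (f v)" "Suc i"] by auto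
  qed (auto simp: f_def intro: Least_le)
  have fibre: "card {v. f v = i} = x ! i" if "i < n" for i
  proof -
    have "f v = i \<longleftrightarrow> S i \<le> v \<and> v < S (Suc i)" for v
    proof (cases i)
      case 0
      then have "f v = i \<longleftrightarrow> f v \<le> i" by simp
      then show ?thesis using f_le_iff[OF that, of v] 0 by (simp add: S_def)
    next
      case (Suc i')
      then have "f v = i \<longleftrightarrow> f v \<le> i \<and> \<not> f v \<le> i'" by auto
      also have "\<dots> \<longleftrightarrow> v < S (Suc i) \<and> \<not> v < S (Suc i')"
        using f_le_iff[OF that, of v] f_le_iff[of i' v] that Suc by simp
      finally show ?thesis using Suc by auto
    qed
    then have "{v. f v = i} = {S i..<S (Suc i)}"
      unfolding set_eq_iff mem_Collect_eq atLeastLessThan_iff by blast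
    moreover have "S (Suc i) = S i + x ! i"
      using that by (simp add: S_def n_def take_Suc_conv_app_nth)
    ultimately show ?thesis by simp
  qed
  have cnt_f: "cnt (Suc i) (map f c) = cnt (S (Suc i)) c" if "i < n" for i c
    using f_le_iff[OF that] by (simp add: cnt_def filter_map o_def less_Suc_eq_le)
  have "below (\<lambda>i. S (Suc i)) n = (\<Union>d\<in>below Suc n. {c. map f c = d})"
    by (auto simp: below_def cnt_f)
  then have "card (below (\<lambda>i. S (Suc i)) n) = (\<Sum>d\<in>below Suc n. card {c. map f c = d})"
  proof (simp only:, intro card_UN_disjoint)
    show "\<forall>d\<in>below Suc n. finite {c. map f c = d}"
      using finite_below[of "\<lambda>i. S (Suc i)" n]
      unfolding \<open>below (\<lambda>i. S (Suc i)) n = _\<close> by (simp add: finite_below)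
  qed (auto simp: finite_below)
  also have "\<dots> = (\<Sum>d\<in>below Suc n. prod_list (map ((!) x) d))"
  proof (rule sum.cong)
    fix d assume d: "d \<in> below Suc n"
    have "v < n" if "v \<in> set d" for v using below_Suc_less[OF d that] .
    then show "card {c. map f c = d} = prod_list (map ((!) x) d)"
      unfolding card_map_fibre by (intro arg_cong[of _ _ prod_list] map_cong) (auto simp: fibre)
  qed simp
  finally show ?thesis by (simp add: parking_poly_eq n_def S_def)
qed

section \<open>Labelled lattice paths\<close>

text \<open>The list \<open>lss ! h\<close> holds the labels of the East steps at height \<open>h\<close>. Every path in
  \<open>rational_parking\<close> ends with a North step and hence has this form.\<close>

definition path_of :: "nat list list \<Rightarrow> step list" where
  "path_of lss = concat (map (\<lambda>ls. map East ls @ [North]) lss)"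

lemma path_of_simps [simp]:
  "path_of [] = []" "path_of (ls # lss) = map East ls @ North # path_of lss"
  "path_of (xs @ ys) = path_of xs @ path_of ys"
  by (simp_all add: path_of_def)

lemma step_count_simps [simp]:
  "norths [] = 0" "norths (North # p) = Suc (norths p)" "norths (East l # p) = norths p"
  "norths (p @ q) = norths p + norths q" "norths (map East ls) = 0"
  "easts [] = 0" "easts (North # p) = easts p" "easts (East l # p) = Suc (easts p)"
  "easts (p @ q) = easts p + easts q" "easts (map East ls) = length ls"
  by (simp_all add: norths_def easts_def filter_map o_def)

lemma path_of_counts [simp]:
  "norths (path_of lss) = length lss" "easts (path_of lss) = length (concat lss)"
  "east_labels (path_of lss) = concat lss"
proof -
  show "norths (path_of lss) = length lss" "easts (path_of lss) = length (concat lss)"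
    by (induction lss) auto
  show "east_labels (path_of lss) = concat lss"
    by (induction lss) (auto simp: east_labels_def filter_map o_def)
qed

lemma inj_path_of: "inj path_of"
proof (rule injI)
  fix xss yss assume "path_of xss = path_of yss"
  then show "xss = yss"
  proof (induction xss arbitrary: yss)
    case Nil
    then show ?case by (cases yss) auto
  next
    case (Cons xs xss)
    then obtain ys yss' where yss: "yss = ys # yss'" by (cases yss) auto
    have tw: "takeWhile (\<lambda>s. s \<noteq> North) (map East zs @ North # p) = map East zs" for zs p
      by (induction zs) auto
    have "map East xs = map East ys"
      using Cons.prems yss tw by (metis path_of_simps(2))
    then have "xs = ys" by (metis inj_map_eq_map inj_def step.inject)
    then show ?case using Cons yss by simp
  qed
qed

lemma path_of_surj:
  assumes "p = [] \<or> last p = North"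
  shows "\<exists>lss. p = path_of lss"
  using assms
proof (induction p)
  case Nil
  show ?case by (rule exI[of _ "[]"]) simp
next
  case (Cons s p)
  show ?case
  proof (cases s)
    case North
    obtain lss where "p = path_of lss" using Cons by (auto split: if_splits)
    then show ?thesis using North by (intro exI[of _ "[] # lss"]) simp
  next
    case (East l)
    then have "p \<noteq> []" "last p = North" using Cons.prems by (auto split: if_splits)
    then obtain lss where lss: "p = path_of lss" using Cons.IH by blast
    then obtain ls lss' where "lss = ls # lss'" using \<open>p \<noteq> []\<close> by (cases lss) auto
    then show ?thesis using East lss by (intro exI[of _ "(l # ls) # lss'"]) simp
  qed
qed

text \<open>The North step number \<open>h\<close> comes after all East steps at the first
  \<open>h\<close> heights.\<close>

lemma take_path_of:
  "\<exists>h\<le>length lss. norths (take m (path_of lss)) = h \<and>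
    length (concat (take h lss)) \<le> easts (take m (path_of lss))"
proof (induction lss arbitrary: m)
  case (Cons ls lss)
  show ?case
  proof (cases "m \<le> length ls")
    case True
    then show ?thesis by (simp add: take_map)
  next
    case False
    then obtain m' where m: "m = length ls + Suc m'"
      by (metis add_Suc_right less_imp_Suc_add not_le)
    from Cons[of m'] show ?thesis by (simp add: m)
  qed
qed simp

text \<open>East steps only move away from the line, so at each height the point reached by the
  North step is the critical one.\<close>

lemma path_below_line_iff:
  "(\<forall>m\<le>length (path_of lss). b * norths (take m (path_of lss)) \<le> a * easts (take m (path_of lss)))
    \<longleftrightarrow> (\<forall>h\<le>length lss. b * h \<le> a * length (concat (take h lss)))"
proof (intro iffI allI impI)
  fix h assume *: "\<forall>m\<le>length (path_of lss). b * norths (take m (path_of lss)) \<le> a * easts (take m (path_of lss))"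
    and h: "h \<le> length lss"
  let ?m = "length (path_of (take h lss))"
  have split: "path_of lss = path_of (take h lss) @ path_of (drop h lss)"
    by (metis append_take_drop_id path_of_simps(3))
  then have "take ?m (path_of lss) = path_of (take h lss)" "?m \<le> length (path_of lss)" by simp_all
  then have "b * norths (path_of (take h lss)) \<le> a * easts (path_of (take h lss))"
    using * by metis
  then show "b * h \<le> a * length (concat (take h lss))" using h by simp
next
  fix m assume *: "\<forall>h\<le>length lss. b * h \<le> a * length (concat (take h lss))"
  obtain h where "h \<le> length lss" "norths (take m (path_of lss)) = h"
    "length (concat (take h lss)) \<le> easts (take m (path_of lss))"
    using take_path_of by blast
  then show "b * norths (take m (path_of lss)) \<le> a * easts (take m (path_of lss))"
    using * by (meson le_trans mult_le_mono2)
qed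

text \<open>A North step separates any two blocks, so only neighbours within a block are compared,
  and transitivity extends this to the whole block.\<close>

lemma path_labels_increasing_iff:
  "(\<forall>i l l'. Suc i < length (path_of lss) \<longrightarrow> path_of lss ! i = East l \<longrightarrow>
      path_of lss ! Suc i = East l' \<longrightarrow> l < l') \<longleftrightarrow> (\<forall>ls\<in>set lss. sorted_wrt (<) ls)"
proof -
  define P where "P s s' \<longleftrightarrow> (\<forall>l l'. s = East l \<longrightarrow> s' = East l' \<longrightarrow> l < l')" for s s'
  have block: "successively P (map East ls @ North # p) \<longleftrightarrow> sorted_wrt (<) ls \<and> successively P p" for ls p
  proof -
    have "successively P (North # p) \<longleftrightarrow> successively P p" by (cases p) (auto simp: P_def)
    moreover have "successively P (map East ls) \<longleftrightarrow> sorted_wrt (<) ls"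
      by (simp add: P_def successively_map successively_conv_sorted_wrt)
    ultimately show ?thesis by (auto simp: successively_append_iff P_def)
  qed
  have "successively P (path_of lss) \<longleftrightarrow> (\<forall>ls\<in>set lss. sorted_wrt (<) ls)"
    by (induction lss) (auto simp: block)
  then show ?thesis by (auto simp: successively_conv_nth P_def)
qed

definition label_blocks :: "nat \<Rightarrow> nat \<Rightarrow> nat \<Rightarrow> nat list list set" where
  "label_blocks a b k = {lss. length lss = k * a \<and> distinct (concat lss) \<and> set (concat lss) = {1..k * b} \<and>
     (\<forall>ls\<in>set lss. sorted_wrt (<) ls) \<and> (\<forall>h\<le>k * a. b * h \<le> a * length (concat (take h lss)))}"

lemma rational_parking_eq:
  assumes "0 < a" "0 < b"
  shows "rational_parking a b k = path_of ` label_blocks a b k"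
proof -
  have line: "(of_nat x :: rat) \<le> of_nat a / of_nat b * of_nat y \<longleftrightarrow> b * x \<le> a * y" for x y
  proof -
    have "(of_nat x :: rat) \<le> of_nat a / of_nat b * of_nat y \<longleftrightarrow> (of_nat (b * x) :: rat) \<le> of_nat (a * y)"
      using assms by (simp add: field_simps)
    then show ?thesis by (simp only: of_nat_le_iff)
  qed
  have mem: "path_of lss \<in> rational_parking a b k \<longleftrightarrow> lss \<in> label_blocks a b k" for lss
  proof -
    have "length (concat lss) = k * b" if "distinct (concat lss)" "set (concat lss) = {1..k * b}"
      using distinct_card[OF that(1)] that(2) by simp
    then show ?thesis
      unfolding rational_parking_def label_blocks_def mem_Collect_eq line path_below_line_iff
        path_labels_increasing_iff path_of_counts by auto
  qed
  show ?thesis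
  proof (intro equalityI subsetI)
    fix p assume p: "p \<in> rational_parking a b k"
    \<comment> \<open>Before a final East step the path would already be at height
      \<open>k * a\<close> with only \<open>k * b - 1\<close> East steps, hence above the
      line.\<close>
    have "p = [] \<or> last p = North"
    proof (rule ccontr)
      assume "\<not> ?thesis"
      then obtain q l where q: "p = q @ [East l]"
        by (metis append_butlast_last_id step.exhaust)
      have "\<forall>m\<le>length p. b * norths (take m p) \<le> a * easts (take m p)"
        using p unfolding rational_parking_def mem_Collect_eq line by blast
      moreover have "length q \<le> length p" using q by simp
      ultimately have "b * norths (take (length q) p) \<le> a * easts (take (length q) p)" by blast
      then have "b * norths q \<le> a * easts q" using q by simp
      moreover have "norths q = k * a" "Suc (easts q) = k * b"
        using p q by (auto simp: rational_parking_def)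
      ultimately have "a * Suc (easts q) \<le> a * easts q" by (metis mult.assoc mult.commute)
      then show False using assms by simp
    qed
    then obtain lss where "p = path_of lss" using path_of_surj by blast
    then show "p \<in> path_of ` label_blocks a b k" using p mem by blast
  qed (use mem in blast)
qed

text \<open>Label \<open>l\<close> stands for position \<open>l - 1\<close> of \<open>c\<close>, and
  the entry there is the height of the East step with that label.\<close>

definition blocks_of :: "nat \<Rightarrow> nat \<Rightarrow> nat list \<Rightarrow> nat list list" where
  "blocks_of m n c = map (\<lambda>h. filter (\<lambda>l. c ! (l - 1) = h) [1..<Suc n]) [0..<m]"

lemma mset_concat_filter:
  "mset (concat (map (\<lambda>h. filter (\<lambda>l. g l = h) L) [0..<m])) = mset (filter (\<lambda>l. g l < m) L)"
proof (induction m)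
  case (Suc m)
  have "mset (filter (\<lambda>l. g l < Suc m) L) = mset (filter (\<lambda>l. g l < m) L) + mset (filter (\<lambda>l. g l = m) L)"
    by (induction L) auto
  then show ?case using Suc by simp
qed simp

lemma mset_blocks_of:
  assumes "h \<le> m"
  shows "mset (concat (take h (blocks_of m n c))) = mset (filter (\<lambda>l. c ! (l - 1) < h) [1..<Suc n])"
  using assms mset_concat_filter[of "\<lambda>l. c ! (l - 1)" "[1..<Suc n]" h]
  by (simp add: blocks_of_def take_map del: upt_Suc mset_filter)

lemma length_blocks_of:
  assumes "h \<le> m" "length c = n"
  shows "length (concat (take h (blocks_of m n c))) = cnt h c"
proof -
  have c: "c = map (\<lambda>l. c ! (l - 1)) [1..<Suc n]"
    using assms by (intro nth_equalityI) (auto simp del: upt_Suc)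
  have "cnt h c = length (filter (\<lambda>l. c ! (l - 1) < h) [1..<Suc n])"
    by (subst c) (simp add: cnt_def filter_map o_def del: upt_Suc)
  then show ?thesis using mset_blocks_of[OF assms(1)] by (metis size_mset)
qed

lemma disjoint_blocks:
  "distinct (concat lss) \<Longrightarrow> i < j \<Longrightarrow> j < length lss \<Longrightarrow> set (lss ! i) \<inter> set (lss ! j) = {}"
proof (induction lss arbitrary: i j)
  case (Cons ls lss)
  then obtain j' where j: "j = Suc j'" by (cases j) auto
  then have "set (lss ! j') \<subseteq> set (concat lss)" using Cons.prems by auto
  then show ?case using Cons j by (cases i) auto
qed simp

text \<open>An increasing block is determined by its set of labels, so a labelled path amounts to a
  map from labels to heights. The number of East steps before the North step number \<open>h\<close>
  is \<open>cnt h c\<close>, so the line condition becomes domination.\<close>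

lemma bij_betw_blocks_of:
  assumes "0 < a" "0 < b"
  shows "bij_betw (blocks_of (k * a) (k * b)) (dominated a b k) (label_blocks a b k)"
proof (rule bij_betw_imageI)
  let ?m = "k * a" and ?n = "k * b"
  note dom = dominated_iff[OF assms]
  have vals: "\<forall>v\<in>set c. v < ?m" if "c \<in> dominated a b k" for c
    using dominated_less[OF assms that] by blast
  have len: "length c = ?n" if "c \<in> dominated a b k" for c
    using that by (simp add: dom)
  have nth_block: "set (blocks_of ?m ?n c ! h) = {l \<in> {1..?n}. c ! (l - 1) = h}" if "h < ?m" for c h
    using that by (auto simp: blocks_of_def simp del: upt_Suc)
  show "inj_on (blocks_of ?m ?n) (dominated a b k)"
  proof (rule inj_onI)
    fix c d assume c: "c \<in> dominated a b k" and d: "d \<in> dominated a b k"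
      and eq: "blocks_of ?m ?n c = blocks_of ?m ?n d"
    show "c = d"
    proof (rule nth_equalityI)
      fix i assume i: "i < length c"
      then have h: "c ! i < ?m" using vals[OF c] by simp
      have "Suc i \<in> set (blocks_of ?m ?n c ! (c ! i))"
        using i len[OF c] by (simp add: nth_block[OF h])
      then show "c ! i = d ! i" unfolding eq nth_block[OF h] by simp
    qed (simp add: len[OF c] len[OF d])
  qed
  have into: "blocks_of ?m ?n c \<in> label_blocks a b k" if c: "c \<in> dominated a b k" for c
  proof -
    have "c ! (l - 1) < ?m" if "l \<in> set [1..<Suc ?n]" for l
      using vals[OF c] len[OF c] that by (auto simp del: upt_Suc)
    then have "filter (\<lambda>l. c ! (l - 1) < ?m) [1..<Suc ?n] = [1..<Suc ?n]" by simp
    then have mset: "mset (concat (blocks_of ?m ?n c)) = mset [1..<Suc ?n]"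
      using mset_blocks_of[of ?m ?m ?n c] by (simp add: blocks_of_def del: upt_Suc mset_filter)
    then have "set (concat (blocks_of ?m ?n c)) = {1..?n}"
      by (metis atLeastLessThanSuc_atLeastAtMost set_mset_mset set_upt)
    moreover have "distinct (concat (blocks_of ?m ?n c))"
      using mset_eq_imp_distinct_iff[OF mset] by simp
    moreover have "sorted_wrt (<) ls" if "ls \<in> set (blocks_of ?m ?n c)" for ls
      using that by (auto simp: blocks_of_def sorted_wrt_filter simp del: upt_Suc)
    moreover have "b * h \<le> a * length (concat (take h (blocks_of ?m ?n c)))" if "h \<le> ?m" for h
      using c that length_blocks_of[OF that len[OF c]] by (simp add: dom)
    ultimately show ?thesis by (simp add: label_blocks_def blocks_of_def del: upt_Suc)
  qed
  show "blocks_of ?m ?n ` dominated a b k = label_blocks a b k"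
  proof (intro equalityI subsetI)
    fix lss assume "lss \<in> label_blocks a b k"
    then have lss: "length lss = ?m" "distinct (concat lss)" "set (concat lss) = {1..?n}"
      "\<And>ls. ls \<in> set lss \<Longrightarrow> sorted_wrt (<) ls" "\<And>h. h \<le> ?m \<Longrightarrow> b * h \<le> a * length (concat (take h lss))"
      by (auto simp: label_blocks_def)
    define g where "g l = (SOME h. h < ?m \<and> l \<in> set (lss ! h))" for l
    have g_eq: "g l = h" if "h < ?m" "l \<in> set (lss ! h)" for l h
    proof -
      have "g l < ?m \<and> l \<in> set (lss ! g l)" unfolding g_def by (rule someI[of _ h]) (use that in simp)
      then show ?thesis
        using disjoint_blocks[OF lss(2), of h "g l"] disjoint_blocks[OF lss(2), of "g l" h] that lss(1)
        by (metis disjoint_iff linorder_neqE_nat)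
    qed
    have g_mem: "g l < ?m \<and> l \<in> set (lss ! g l)" if "l \<in> {1..?n}" for l
    proof -
      have "l \<in> set (concat lss)" using that lss(3) by simp
      then obtain ls where "ls \<in> set lss" "l \<in> set ls" by auto
      then obtain h where "h < ?m" "l \<in> set (lss ! h)" using lss(1) by (metis in_set_conv_nth)
      then show ?thesis using g_eq by simp
    qed
    define c where "c = map g [1..<Suc ?n]"
    have len_c: "length c = ?n" by (simp add: c_def del: upt_Suc)
    have c_nth: "c ! (l - 1) = g l" if "l \<in> {1..?n}" for l
    proof -
      obtain i where "l = Suc i" "i < ?n" using \<open>l \<in> {1..?n}\<close> by (cases l) auto
      then show ?thesis by (simp add: c_def del: upt_Suc)
    qed
    have blocks: "blocks_of ?m ?n c = lss"
    proof (rule nth_equalityI)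
      fix h assume "h < length (blocks_of ?m ?n c)"
      then have h: "h < ?m" by (simp add: blocks_of_def)
      have "lss ! h \<in> set lss" using h lss(1) by simp
      then have "set (lss ! h) \<subseteq> {1..?n}" unfolding lss(3)[symmetric] by auto
      then have "set (lss ! h) = {l \<in> {1..?n}. g l = h}" using g_eq[OF h] g_mem by blast
      also have "\<dots> = set (blocks_of ?m ?n c ! h)"
        unfolding nth_block[OF h] by (rule Collect_cong) (metis c_nth)
      finally have set_eq: "set (blocks_of ?m ?n c ! h) = set (lss ! h)" ..
      have "sorted_wrt (<) (lss ! h)" using lss(1,4) h by simp
      moreover have "sorted_wrt (<) (blocks_of ?m ?n c ! h)"
        using h by (simp add: blocks_of_def sorted_wrt_filter del: upt_Suc)
      ultimately show "blocks_of ?m ?n c ! h = lss ! h"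
        using set_eq by (intro strict_sorted_equal)
    qed (simp add: blocks_of_def lss(1))
    have "b * h \<le> a * cnt h c" if "h \<le> ?m" for h
      using lss(5)[OF that] length_blocks_of[OF that len_c] unfolding blocks by simp
    then have "c \<in> dominated a b k" using len_c by (simp add: dom)
    then show "lss \<in> blocks_of ?m ?n ` dominated a b k" using blocks by blast
  qed (use into in blast)
qed

lemma PF_eq_card_dominated:
  assumes "0 < a" "0 < b"
  shows "PF a b k = card (dominated a b k)"
proof -
  have "PF a b k = card (label_blocks a b k)"
    unfolding PF_def rational_parking_eq[OF assms]
    by (rule card_image) (rule inj_on_subset[OF inj_path_of subset_UNIV])
  then show ?thesis using bij_betw_same_card[OF bij_betw_blocks_of[OF assms]] by simp
qed

section \<open>Periodic vectors and polynomial dependence on \<open>a\<close>\<close>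

text \<open>The number \<open>a\<close> is replaced by a field element \<open>q\<close>, so that an
  entry can be read as a polynomial of degree at most 1 in \<open>q\<close>.\<close>

definition entry :: "'a::field \<Rightarrow> nat \<Rightarrow> nat \<Rightarrow> 'a" where
  "entry q b i = (if i = 0 then 1 else if b dvd i then (q + of_nat b - 1) / of_nat b else (q - 1) / of_nat b)"

lemma concat_replicate_cycle:
  assumes "0 < b"
  shows "concat (replicate m (x # replicate (b - 1) y)) = map (\<lambda>i. if b dvd i then x else y) [0..<m * b]"
proof (induction m)
  case (Suc m)
  have cycle: "x # replicate (b - 1) y = map (\<lambda>i. if b dvd i then x else y) [0..<b]"
    using assms by (intro nth_equalityI) (auto simp: nth_Cons split: nat.splits dest: nat_dvd_not_less)
  have "map (\<lambda>i. if b dvd i then x else y) [0..<m * b] =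
      map (\<lambda>i. if b dvd i then x else y) [b..<b + m * b]"
    by (intro nth_equalityI) auto
  then show ?case
    using Suc cycle by (simp add: upt_add_eq_append[of 0 b] del: upt_Suc flip: map_append)
qed simp

lemma periodic_vector_eq:
  assumes "0 < b" "1 \<le> k"
  shows "periodic_vector a b k = map (entry (of_nat a) b) [0..<k * b]"
proof -
  let ?x = "(of_nat a + of_nat b - 1) / of_nat b :: rat" and ?y = "(of_nat a - 1) / of_nat b :: rat"
  have "periodic_vector a b k = (concat (replicate k (?x # replicate (b - 1) ?y)))[0 := 1]"
    using assms(2) by (cases k) (simp_all add: periodic_vector_def)
  also have "\<dots> = map (entry (of_nat a) b) [0..<k * b]"
    unfolding concat_replicate_cycle[OF assms(1)]
    by (intro nth_equalityI) (auto simp: entry_def nth_list_update)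
  finally show ?thesis .
qed

text \<open>Since (a + b - 1)/b = 1 + (a - 1)/b, the scaled vector adds \<beta> at each index after
  the first, and a further \<open>N\<close> whenever a cycle starts.\<close>

lemma scaled_periodic_vector:
  assumes b: "0 < b" "1 \<le> k" and y: "map of_nat y = map (\<lambda>q. of_nat N * q) (periodic_vector a b k)"
    and \<beta>: "of_nat \<beta> = (of_nat N * ((of_nat a - 1) / of_nat b) :: rat)"
  shows "length y = k * b" "below (\<lambda>i. sum_list (take (Suc i) y)) (k * b) = stair N \<beta> b k (k * b)"
proof -
  have y': "map of_nat y = map (\<lambda>i. of_nat N * entry (of_nat a) b i :: rat) [0..<k * b]"
    unfolding y periodic_vector_eq[OF b] by simp
  from arg_cong[OF y', of length] show len: "length y = k * b" by simp
  have nth: "y ! i = (if i = 0 then N else if b dvd i then N + \<beta> else \<beta>)" if "i < k * b" for i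
  proof -
    have "(of_nat (y ! i) :: rat) = of_nat N * entry (of_nat a) b i"
      using arg_cong[OF y', of "\<lambda>l. l ! i"] that by (simp only: nth_map len) simp
    also have "\<dots> = of_nat (if i = 0 then N else if b dvd i then N + \<beta> else \<beta>)"
      using b by (simp add: entry_def \<beta> field_simps)
    finally show ?thesis by (simp only: of_nat_eq_iff)
  qed
  have sum: "sum_list (take (Suc i) y) = N * Suc (i div b) + i * \<beta>" if "i < k * b" for i
    using that
  proof (induction i)
    case 0
    then show ?case using nth[of 0] len by (simp add: take_Suc_conv_app_nth)
  next
    case (Suc i)
    then have "sum_list (take (Suc (Suc i)) y) = sum_list (take (Suc i) y) + y ! Suc i"
      using len by (simp add: take_Suc_conv_app_nth del: take_Suc)
    then show ?case
      using Suc nth[of "Suc i"] by (simp add: div_Suc dvd_eq_mod_eq_0)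
  qed
  show "below (\<lambda>i. sum_list (take (Suc i) y)) (k * b) = stair N \<beta> b k (k * b)"
    unfolding stair_def
  proof (rule below_cong)
    fix i assume i: "i < k * b"
    then have "min (Suc (i div b)) k = Suc (i div b)"
      using b by (simp add: Suc_le_eq div_less_iff_less_mult)
    then show "sum_list (take (Suc i) y) = N * min (Suc (i div b)) k + i * \<beta>"
      using sum[OF i] by simp
  qed
qed

section \<open>Blocks of positions\<close>

lemma basic_parking_map_Suc:
  assumes "d \<in> below (\<lambda>i. \<alpha> + i * \<beta>) j"
  shows "basic_parking \<alpha> \<beta> (map Suc d)"
proof -
  have len: "length d = j" using assms by (simp add: below_def)
  have "below (\<lambda>i. sum_list (take (Suc i) (basic_vector \<alpha> \<beta> j))) j = below (\<lambda>i. \<alpha> + i * \<beta>) j"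
    by (rule below_cong) (auto simp: basic_vector_def sum_list_replicate)
  moreover have "length (basic_vector \<alpha> \<beta> j) = j" by (simp add: basic_vector_def)
  ultimately show ?thesis
    using assms len by (simp add: basic_parking_def vector_parking_iff)
qed

text \<open>The value intervals of \<open>stair_decomposition\<close> are pulled back to sets of
  positions.\<close>

lemma block_decomposition_exists:
  assumes "0 < b" "d \<in> stair N \<beta> b k (k * b)"
  shows "\<exists>B. block_decomposition N \<beta> k b (map Suc d) B"
proof -
  obtain J where J: "J \<in> specs k (k * b) b" and top: "\<forall>v\<in>set d. v < (\<Sum>i<k. N + J ! i * \<beta>)"
    and J_below: "\<forall>s<k. map (\<lambda>v. v - (\<Sum>i<s. N + J ! i * \<beta>))
      (filter (\<lambda>v. (\<Sum>i<s. N + J ! i * \<beta>) \<le> v \<and> v < (\<Sum>i<Suc s. N + J ! i * \<beta>)) d)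
      \<in> below (\<lambda>i. N + i * \<beta>) (J ! s)"
    using stair_decomposition[OF assms(1) le_refl assms(2)] by blast
  define off where "off s = (\<Sum>i<s. N + J ! i * \<beta>)" for s
  let ?P = "\<lambda>s v. off s \<le> v \<and> v < off (Suc s)"
  have off_mono: "s \<le> s' \<Longrightarrow> off s \<le> off s'" for s s'
    unfolding off_def by (rule sum_mono2) auto
  define B where "B = map (\<lambda>s. {p. p < length d \<and> ?P s (d ! p)}) [0..<k]"
  have len_J: "length J = k" using J by (simp add: specs_def)
  have B_nth: "B ! s = {p. p < length d \<and> ?P s (d ! p)}" if "s < k" for s
    using that by (simp add: B_def)
  have below: "map (\<lambda>v. v - off s) (filter (?P s) d) \<in> below (\<lambda>i. N + i * \<beta>) (J ! s)" if "s < k" for s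
    using J_below that unfolding off_def by blast
  have card_B: "card (B ! s) = J ! s" if "s < k" for s
    using below[OF that] by (simp add: B_nth[OF that] below_def length_filter_conv_card)
  have "map card B = J"
    using card_B by (intro nth_equalityI) (simp_all add: B_def len_J)
  moreover have "\<Union>(set B) = {..<length (map Suc d)}"
  proof (intro equalityI subsetI)
    fix p assume p: "p \<in> {..<length (map Suc d)}"
    then have "d ! p < off k" using top by (simp add: off_def)
    then have ex: "\<exists>s. d ! p < off s" ..
    \<comment> \<open>The entry lies below the offset \<open>off k\<close> and \<open>off 0\<close>
      is 0, so the first offset above it has a predecessor, which is the index of its block.\<close>
    define s where "s = (LEAST s. d ! p < off s)"
    have s: "d ! p < off s" unfolding s_def using ex by (rule LeastI_ex)
    then obtain s' where s': "s = Suc s'" by (cases s) (auto simp: off_def)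
    have "\<not> d ! p < off s'" using not_less_Least[of s' "\<lambda>s. d ! p < off s"] s' unfolding s_def by simp
    moreover have "s \<le> k" unfolding s_def by (rule Least_le) fact
    moreover from this have "s' < k" using s' by simp
    ultimately have "s' < k" "p \<in> B ! s'" using s s' p by (simp_all add: B_nth)
    moreover have "length B = k" by (simp add: B_def)
    ultimately show "p \<in> \<Union>(set B)" by (meson UnionI nth_mem)
  qed (auto simp: B_def)
  moreover have "B ! s \<inter> B ! t = {}" if "s < k" "t < k" "s \<noteq> t" for s t
  proof -
    have "B ! s \<inter> B ! t = {}" if "s < t" "t < k" for s t
      using off_mono[of "Suc s" t] that by (auto simp: B_nth)
    then show ?thesis using that by (metis Int_commute linorder_neqE_nat)
  qed
  moreover have "basic_parking N \<beta> (map (\<lambda>v. v - (\<Sum>s<t. N + card (B ! s) * \<beta>)) (nths (map Suc d) (B ! t)))"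
    if t: "t < k" for t
  proof -
    have "(\<Sum>s<t. N + card (B ! s) * \<beta>) = off t"
      unfolding off_def by (rule sum.cong) (use card_B t in auto)
    moreover have "nths (map Suc d) (B ! t) = map Suc (filter (?P t) d)"
      by (simp add: nths_map B_nth[OF t] filter_eq_nths)
    \<comment> \<open>The entries of the block are at least \<open>off t\<close>, so truncated
      subtraction commutes with \<open>Suc\<close>.\<close>
    moreover have "map (\<lambda>v. v - off t) (map Suc (filter (?P t) d)) =
        map Suc (map (\<lambda>v. v - off t) (filter (?P t) d))"
      by (auto simp: Suc_diff_le)
    ultimately have "map (\<lambda>v. v - (\<Sum>s<t. N + card (B ! s) * \<beta>)) (nths (map Suc d) (B ! t)) =
        map Suc (map (\<lambda>v. v - off t) (filter (?P t) d))"
      by (simp only:)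
    then show ?thesis using basic_parking_map_Suc[OF below[OF t]] by (simp only:)
  qed
  ultimately show ?thesis
    using J len_J by (intro exI[of _ B]) (simp add: block_decomposition_def spec_eq_specs B_def)
qed

section \<open>Polynomial dependence on \<open>a\<close>\<close>

lemma card_dominated_is_poly:
  assumes "0 < b"
  shows "\<exists>p::rat poly. \<forall>a>0. coprime a b \<longrightarrow> of_nat (card (dominated a b k)) = poly p (of_nat a)"
proof (induction k rule: less_induct)
  case (less k)
  show ?case
  proof (cases "k = 0")
    case True
    then show ?thesis by (intro exI[of _ 1]) (simp add: dominated_def)
  next
    case False
    obtain P :: "nat \<Rightarrow> rat poly" where P: "\<And>j a. j < k \<Longrightarrow> 0 < a \<Longrightarrow> coprime a b \<Longrightarrow>
        of_nat (card (dominated a b j)) = poly (P j) (of_nat a)"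
      using less by metis
    \<comment> \<open>The recurrence divided by \<open>k * a\<close>: as \<open>j * b\<close> is
      positive, the power of \<open>j * a\<close> can give up one factor \<open>a\<close>, which
      leaves the exponent \<open>j * b - 1\<close>.\<close>
    define p where "p = smult (1 / of_nat k) (\<Sum>j=1..k. smult (of_nat ((k * b choose (j * b)) * j ^ (j * b)))
      (monom 1 (j * b - 1) * P (k - j)))"
    have "of_nat (card (dominated a b k)) = poly p (of_nat a)" if a: "0 < a" "coprime a b" for a
    proof -
      have "(of_nat k * of_nat a * of_nat (card (dominated a b k)) :: rat) =
          (\<Sum>j=1..k. of_nat (k * b choose (j * b)) * (of_nat j * of_nat a) ^ (j * b) *
            of_nat (card (dominated a b (k - j))))"
        using arg_cong[OF dominated_recurrence[OF a(1) assms a(2), of k], of "of_nat :: nat \<Rightarrow> rat"]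
        by simp
      also have "\<dots> = (\<Sum>j=1..k. of_nat a * poly (smult (of_nat ((k * b choose (j * b)) * j ^ (j * b)))
          (monom 1 (j * b - 1) * P (k - j))) (of_nat a))"
      proof (rule sum.cong)
        fix j assume j: "j \<in> {1..k}"
        then have "(of_nat a :: rat) ^ (j * b) = of_nat a * of_nat a ^ (j * b - 1)"
          using assms by (simp add: power_eq_if)
        then show "of_nat (k * b choose (j * b)) * (of_nat j * of_nat a) ^ (j * b) *
            of_nat (card (dominated a b (k - j))) = of_nat a * poly (smult (of_nat ((k * b choose (j * b)) *
              j ^ (j * b))) (monom 1 (j * b - 1) * P (k - j))) (of_nat a)"
          using P[of "k - j" a] j a by (simp add: poly_monom power_mult_distrib)
      qed simp
      also have "\<dots> = of_nat k * of_nat a * poly p (of_nat a)"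
        using False by (simp add: p_def poly_sum sum_distrib_left mult.assoc)
      finally show ?thesis using False a by simp
    qed
    then show ?thesis by blast
  qed
qed

text \<open>The sum ranges over a set that depends only on \<open>k * b\<close>, and every entry is
  a polynomial in \<open>a\<close>.\<close>

lemma parking_poly_periodic_is_poly:
  assumes "0 < b" "1 \<le> k"
  shows "\<exists>p. \<forall>a. parking_poly (periodic_vector a b k) = poly p (of_nat a)"
proof -
  define e :: "nat \<Rightarrow> rat poly" where "e i = (if i = 0 then 1 else
    if b dvd i then [:(of_nat b - 1) / of_nat b, 1 / of_nat b:] else [:- 1 / of_nat b, 1 / of_nat b:])" for i
  have e: "poly (e i) q = entry q b i" for i q
    using assms by (simp add: e_def entry_def field_simps)
  have "parking_poly (periodic_vector a b k) = poly (\<Sum>d\<in>below Suc (k * b). prod_list (map e d)) (of_nat a)" for a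
  proof -
    have "prod_list (map ((!) (periodic_vector a b k)) d) = poly (prod_list (map e d)) (of_nat a)"
      if d: "d \<in> below Suc (k * b)" for d
    proof -
      have "map ((!) (periodic_vector a b k)) d = map (entry (of_nat a) b) d"
        unfolding periodic_vector_eq[OF assms] using below_Suc_less[OF d] by simp
      moreover have "poly (prod_list (map e d)) q = prod_list (map (entry q b) d)" for q
        by (induction d) (simp_all add: e)
      ultimately show ?thesis by (simp only:)
    qed
    moreover have "length (periodic_vector a b k) = k * b" by (simp add: periodic_vector_eq[OF assms])
    ultimately show ?thesis by (simp add: parking_poly_eq poly_sum)
  qed
  then show ?thesis by blast
qed

lemma spec_sum_is_poly:
  "\<exists>p. \<forall>q::rat. (\<Sum>J\<in>spec k b. of_nat (multinomial (k * b) J) *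
    (\<Prod>i<k. (1 + of_nat (J ! i) * ((q - 1) / of_nat b)) powi (int (J ! i) - 1))) = poly p q"
  if "0 < b"
proof -
  \<comment> \<open>For \<open>j = 0\<close> the factor is 1 to the power -1, that is 1; for
    positive \<open>j\<close> the exponent is a natural number.\<close>
  define f :: "nat \<Rightarrow> rat poly" where
    "f j = (if j = 0 then 1 else [:1 - of_nat j / of_nat b, of_nat j / of_nat b:] ^ (j - 1))" for j
  have "(1 + of_nat j * ((q - 1) / of_nat b)) powi (int j - 1) = poly (f j) q" for j q
  proof (cases j)
    case (Suc j')
    have "1 + of_nat j * ((q - 1) / of_nat b) = poly [:1 - of_nat j / of_nat b, of_nat j / of_nat b:] q"
      using that by (simp add: field_simps)
    moreover have "int j - 1 = int (j - 1)" using Suc by simp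
    ultimately show ?thesis using Suc by (simp only: f_def power_int_of_nat poly_power) simp
  qed (simp add: f_def)
  then show ?thesis
    by (intro exI[of _ "\<Sum>J\<in>spec k b. smult (of_nat (multinomial (k * b) J)) (\<Prod>i<k. f (J ! i))"])
      (simp add: poly_sum poly_prod)
qed

lemma dominated_eq_stair:
  assumes "0 < b"
  shows "dominated (1 + b * \<beta>) b k = stair 1 \<beta> b k (k * b)"
  unfolding dominated_def stair_def
proof (rule below_cong)
  fix i assume "i < k * b"
  then have "min (Suc (i div b)) k = Suc (i div b)"
    using assms by (simp add: Suc_le_eq div_less_iff_less_mult)
  moreover have "i * (1 + b * \<beta>) = i + b * (i * \<beta>)" by (simp add: algebra_simps)
  then have "i * (1 + b * \<beta>) div b = i * \<beta> + i div b" using assms by (simp only: div_mult_self2)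
  ultimately show "Suc (i * (1 + b * \<beta>) div b) = 1 * min (Suc (i div b)) k + i * \<beta>" by simp
qed

lemma poly_eqI_infinite:
  fixes p q :: "'a::idom poly"
  assumes "infinite X" "\<And>x. x \<in> X \<Longrightarrow> poly p x = poly q x"
  shows "p = q"
proof (rule ccontr)
  assume "p \<noteq> q"
  then have "finite {x. poly (p - q) x = 0}" by (intro poly_roots_finite) simp
  moreover have "X \<subseteq> {x. poly (p - q) x = 0}" using assms(2) by auto
  ultimately show False using assms(1) finite_subset by blast
qed

lemma of_nat_parking_poly: "of_nat (parking_poly x) = (parking_poly (map of_nat x) :: 'a::comm_semiring_1)"
proof -
  have "of_nat (prod_list (map ((!) x) d)) = (prod_list (map ((!) (map of_nat x)) d) :: 'a)"
    if "d \<in> below Suc (length x)" for d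
  proof -
    have "(of_nat (prod_list (map ((!) x) d)) :: 'a) = prod_list (map (\<lambda>v. of_nat (x ! v)) d)"
      by (induction d) simp_all
    also have "map (\<lambda>v. of_nat (x ! v)) d = map ((!) (map of_nat x :: 'a list)) d"
      using below_Suc_less[OF that] by simp
    finally show ?thesis .
  qed
  then show ?thesis by (simp add: parking_poly_eq)
qed

theorem theorem2p3:
  fixes a b k :: nat
  assumes "0 < a" and "0 < b" and "coprime a b" and "1 \<le> k"
  shows
    "(\<forall>(N::nat) (y::nat list) (c::nat list).
        0 < N \<and> map of_nat y = map (\<lambda>q. of_nat N * q) (periodic_vector a b k) \<and> vector_parking y c
        \<longrightarrow> (\<exists>\<beta> B. (of_nat \<beta> :: rat) = of_nat N * ((of_nat a - 1) / of_nat b) \<and>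
                   block_decomposition N \<beta> k b c B))
     \<and> parking_poly (periodic_vector a b k) = of_nat (PF a b k)
     \<and> (of_nat (PF a b k) :: rat) =
         (\<Sum>J\<in>spec k b. of_nat (multinomial (k * b) J) *
            (\<Prod>i<k. (1 + of_nat (J ! i) * ((of_nat a - 1) / of_nat b)) powi (int (J ! i) - 1)))"
proof (intro conjI allI impI; (elim conjE)?)
  fix N :: nat and y c :: "nat list"
  assume N: "0 < N" and y: "map of_nat y = map (\<lambda>q. of_nat N * q) (periodic_vector a b k)"
    and c: "vector_parking y c"
  \<comment> \<open>For \<open>b > 1\<close> the wanted number is the second entry of the integral
    vector \<open>y\<close>. For \<open>b = 1\<close> the vector may have no such entry, but the
    quotient is integral anyway.\<close>
  have "\<exists>\<beta>. (of_nat \<beta> :: rat) = of_nat N * ((of_nat a - 1) / of_nat b)"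
  proof (cases "b = 1")
    case True
    then show ?thesis using assms(1) by (intro exI[of _ "N * (a - 1)"]) (simp add: of_nat_diff)
  next
    case False
    then have b: "1 < b" using assms(2) by simp
    also have "b \<le> k * b" using assms(4) by simp
    finally have kb: "1 < k * b" .
    have "length y = k * b"
      using arg_cong[OF y, of length] by (simp add: periodic_vector_eq[OF assms(2,4)])
    then have "(of_nat (y ! 1) :: rat) = map of_nat y ! 1" using kb by simp
    then have "of_nat (y ! 1) = (of_nat N * ((of_nat a - 1) / of_nat b) :: rat)"
      unfolding y periodic_vector_eq[OF assms(2,4)] using b kb by (simp add: entry_def)
    then show ?thesis ..
  qed
  then obtain \<beta> where \<beta>: "(of_nat \<beta> :: rat) = of_nat N * ((of_nat a - 1) / of_nat b)" ..
  note sv = scaled_periodic_vector[OF assms(2,4) y \<beta>]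
  from c obtain d where "c = map Suc d" "d \<in> stair N \<beta> b k (k * b)"
    unfolding vector_parking_iff sv by blast
  then show "\<exists>\<beta> B. (of_nat \<beta> :: rat) = of_nat N * ((of_nat a - 1) / of_nat b) \<and>
      block_decomposition N \<beta> k b c B"
    using block_decomposition_exists[OF assms(2)] \<beta> by blast
next
  let ?sum = "\<lambda>q::rat. \<Sum>J\<in>spec k b. of_nat (multinomial (k * b) J) *
    (\<Prod>i<k. (1 + of_nat (J ! i) * ((q - 1) / of_nat b)) powi (int (J ! i) - 1))"
  obtain p1 :: "rat poly" where p1: "\<And>a. 0 < a \<Longrightarrow> coprime a b \<Longrightarrow>
      of_nat (card (dominated a b k)) = poly p1 (of_nat a)"
    using card_dominated_is_poly[OF assms(2)] by blast
  obtain p2 where p2: "\<And>a. parking_poly (periodic_vector a b k) = poly p2 (of_nat a)"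
    using parking_poly_periodic_is_poly[OF assms(2,4)] by blast
  obtain p3 where p3: "\<And>q. ?sum q = poly p3 q"
    using spec_sum_is_poly[OF assms(2)] by blast
  \<comment> \<open>Here the vector is integral without scaling, so the staircase with
    \<open>N = 1\<close> is the set behind all three quantities.\<close>
  have special: "parking_poly (periodic_vector (1 + b * \<beta>) b k) = of_nat (card (dominated (1 + b * \<beta>) b k))"
    "of_nat (card (dominated (1 + b * \<beta>) b k)) = ?sum (of_nat (1 + b * \<beta>))" for \<beta>
  proof -
    define y where "y = map (\<lambda>i. if i = 0 then 1 else if b dvd i then 1 + \<beta> else \<beta>) [0..<k * b]"
    have "map of_nat y = periodic_vector (1 + b * \<beta>) b k"
      unfolding y_def periodic_vector_eq[OF assms(2,4)] map_map
      by (rule map_cong[OF refl]) (use assms(2) in \<open>simp add: entry_def field_simps\<close>)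
    then have y: "map of_nat y = periodic_vector (1 + b * \<beta>) b k"
      "map of_nat y = map (\<lambda>q. of_nat 1 * q) (periodic_vector (1 + b * \<beta>) b k)" by simp_all
    have \<beta>: "of_nat \<beta> = (of_nat 1 * ((of_nat (1 + b * \<beta>) - 1) / of_nat b) :: rat)"
      using assms(2) by simp
    note sv = scaled_periodic_vector[OF assms(2,4) y(2) \<beta>]
    have "parking_poly (periodic_vector (1 + b * \<beta>) b k) = of_nat (parking_poly y)"
      by (simp add: of_nat_parking_poly y(1))
    then show "parking_poly (periodic_vector (1 + b * \<beta>) b k) = of_nat (card (dominated (1 + b * \<beta>) b k))"
      using card_below_prefix_sums[of y] unfolding dominated_eq_stair[OF assms(2)] sv by simp
    have "(1 + of_nat j * ((of_nat (1 + b * \<beta>) - 1) / of_nat b)) powi (int j - 1) =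
        (of_nat ((1 + j * \<beta>) ^ (j - 1)) :: rat)" for j
    proof (cases j)
      case (Suc j')
      then have "int j - 1 = int (j - 1)" by simp
      then show ?thesis using assms(2) by (simp only: power_int_of_nat) simp
    qed simp
    then have "?sum (of_nat (1 + b * \<beta>)) =
        of_nat (\<Sum>J\<in>spec k b. multinomial (k * b) J * (\<Prod>i<k. (1 + J ! i * \<beta>) ^ (J ! i - 1)))"
      by (simp only: of_nat_sum of_nat_mult of_nat_prod)
    also have "\<dots> = of_nat (card (stair 1 \<beta> b k (k * b)))"
      unfolding card_stair[OF assms(2) le_refl] card_below_basic spec_eq_specs ..
    finally show "of_nat (card (dominated (1 + b * \<beta>) b k)) = ?sum (of_nat (1 + b * \<beta>))"
      unfolding dominated_eq_stair[OF assms(2)] ..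
  qed
  let ?X = "range (\<lambda>\<beta>. of_nat (1 + b * \<beta>) :: rat)"
  have "inj (\<lambda>\<beta>. of_nat (1 + b * \<beta>) :: rat)"
    using assms(2) by (auto intro!: injI)
  then have inf: "infinite ?X" by (rule range_inj_infinite)
  have "poly p1 x = poly p2 x \<and> poly p1 x = poly p3 x" if x: "x \<in> ?X" for x
  proof -
    obtain \<beta> where \<beta>: "x = of_nat (1 + b * \<beta>)" using x by blast
    have "poly p1 x = of_nat (card (dominated (1 + b * \<beta>) b k))"
      unfolding \<beta> by (rule p1[OF _ coprime_1_add_mult, symmetric]) simp
    moreover have "poly p2 x = of_nat (card (dominated (1 + b * \<beta>) b k))"
      unfolding \<beta> special(1)[symmetric] by (rule p2[symmetric])
    moreover have "poly p3 x = of_nat (card (dominated (1 + b * \<beta>) b k))"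
      unfolding \<beta> special(2) by (rule p3[symmetric])
    ultimately show ?thesis by (simp only:)
  qed
  then have "p1 = p2" "p1 = p3" using poly_eqI_infinite[OF inf] by blast+
  then show "parking_poly (periodic_vector a b k) = of_nat (PF a b k)"
    "(of_nat (PF a b k) :: rat) = ?sum (of_nat a)"
    unfolding p2 p3 PF_eq_card_dominated[OF assms(1,2)] p1[OF assms(1,3)] by simp_all
qed

end
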